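(* Let $g \ge 1$, let $a_1,\ldots,a_{g+1} \in \mathbb{Q}^\times$ be pairwise distinct, and let $\epsilon_1,\ldots,\epsilon_{g+1} \in \{\pm1\}$ be not all equal to $-1$. Let $V=\left(a_i^j\right)_{1\le i \le g+1,\ 0 \le j \le g}\in \mathrm{GL}_{g+1}(\mathbb{Q})$ be the Vandermonde matrix, let $w = \left(-2a^{g+1}_i- 2\epsilon_i a^{g+1}_i\right)_{1\le i \le g+1} \in \mathbb{Q}^{g+1}$, define $(b_0,\ldots,b_g) = V^{-1} w \in \mathbb{Q}^{g+1}$ and put $$f_1(x) = b_0+b_1x+\ldots + b_gx^g+2x^{g+1}.$$ Assume that $b_g\ne 0$ and $\mathrm{disc}(-4x^{2g+2}+f_1(x)^2)\neq 0$, and let $C$ be the hyperelliptic curve (smooth projective model) associated to the affine model $$y^2+f_1(x)y+x^{2g+2} =0 .$$ Let $\infty$ be the unique point at infinity on $C$ and $O=(0,0)\in C(\mathbb{Q})$. Then, for every $i\in\{1,\ldots,g+1\}$, the points $\infty$, $O$ and $P_i = (a_i,\epsilon_ia_i^{g+1}) \in C(\mathbb{Q})$ define (in the sense explained in the context) an element $\{\infty, O, P_i\}\in K_2^T(C)/\mathrm{torsion}$.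
   Context: For a smooth, projective, geometrically irreducible curve $C/\mathbb{Q}$ let $K_2(\mathbb{Q}(C)) = \mathbb{Q}(C)^\times\otimes_{\mathbb{Z}} \mathbb{Q}(C)^\times/\langle f\otimes (1-f): f \in \mathbb{Q}(C)^\times\setminus\{1\}\rangle$, and write $\{f,h\}$ for the class of $f\otimes h$. For a closed point $P$ of $C$ with residue field $\mathbb{Q}(P)$ the tame symbol is $T_P(\{f,h\}) = (-1)^{\mathrm{ord}_P(f)\mathrm{ord}_P(h)}\frac{f^{\mathrm{ord}_P(h)}}{h^{\mathrm{ord}_P(f)}}(P)\in \mathbb{Q}(P)^\times$, extended linearly to $K_2(\mathbb{Q}(C))$. The tame second $K$-group $K_2^T(C)$ is the subgroup of those $\alpha\in K_2(\mathbb{Q}(C))$ with $T_P(\alpha)=1$ for all closed points $P$. Torsion construction: let $R_1,R_2,R_3\in C(\mathbb{Q})$ be distinct points such that all differences $(R_i)-(R_j)$ have torsion class in $\mathrm{Pic}^0(C)$. With indices in $\mathbb{Z}/3\mathbb{Z}$, let $m_i\ge 1$ be the order of the class of $(R_{i+1})-(R_{i-1})$, let $h_i\in\mathbb{Q}(C)^\times$ satisfy $\mathrm{div}(h_i)=m_i(R_{i+1})-m_i(R_{i-1})$, and put $S_i=\left\{\frac{h_{i+1}}{h_{i+1}(R_{i+1})},\frac{h_{i-1}}{h_{i-1}(R_{i-1})}\right\}$. It is known that $S_i\in K_2^T(C)$ and that there is a unique element $\{R_1,R_2,R_3\}\in K_2^T(C)/\mathrm{torsion}$ with $S_i=\frac{\mathrm{lcm}(m_1,m_2,m_3)}{m_i}\{R_1,R_2,R_3\}$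 for all $i$. Saying that a triple of points defines an element $\{R_1,R_2,R_3\}$ of $K_2^T(C)/\mathrm{torsion}$ means that the three points are distinct rational points whose pairwise differences are torsion in $\mathrm{Pic}^0(C)$, so that this construction applies. *)

theory Defs
  imports
    "HOL-Computational_Algebra.Fraction_Field"
    "HOL-Computational_Algebra.Polynomial_Factorial"
    "HOL-Algebra.QuotRing"
    "HOL-Algebra.Embedded_Algebras"
    "HOL-Algebra.Free_Abelian_Groups"
    "Jordan_Normal_Form.Gauss_Jordan_Elimination"
    "Subresultants.Resultant_Prelim"
begin

section \<open>Discriminant of a polynomial\<close>

definition discriminant :: "'a::field_char_0 poly \<Rightarrow> 'a" where
  "discriminant p =
     (-1) ^ (degree p * (degree p - 1) div 2) * resultant p (pderiv p) / lead_coeff p"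

section \<open>The function field of the curve \<open>y\<^sup>2 + p(x) y + q(x) = 0\<close> over the rationals\<close>

text \<open>
  Elements of \<open>\<rat>(x)[y]/(y\<^sup>2 + p(x) y + q(x))\<close> are written uniquely as \<open>A + B y\<close> with
  \<open>A, B \<in> \<rat>(x)\<close> and represented by the pair \<open>(A, B)\<close>; the product comes from
  \<open>y\<^sup>2 = - p y - q\<close>. This ring is a field, and is the function field of the curve, exactly when
  \<open>p\<^sup>2 - 4 q\<close> is not a square.
\<close>

type_synonym fn = "rat poly fract \<times> rat poly fract"

definition function_field :: "rat poly \<Rightarrow> rat poly \<Rightarrow> fn ring" where
  "function_field p q =
     \<lparr> carrier = UNIV,
       monoid.mult = (\<lambda>(A, B) (A', B').
         (A * A' - to_fract q * B * B', A * B' + B * A' - to_fract p * B * B')),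
       one = (1, 0),
       ring.zero = (0, 0),
       ring.add = (\<lambda>(A, B) (A', B'). (A + A', B + B')) \<rparr>"

definition const_fn :: "rat \<Rightarrow> fn" where "const_fn c = (to_fract [:c:], 0)"
definition x_fn :: fn where "x_fn = (to_fract [:0, 1:], 0)"
definition y_fn :: fn where "y_fn = (0, 1)"

section \<open>Closed points of the smooth projective model\<close>

text \<open>
  The smooth projective curve \<open>C\<close> with function field \<open>K\<close> is used in its standard description as an
  abstract nonsingular curve: a closed point \<open>P\<close> of \<open>C\<close> is the same thing as a normalised discrete
  valuation of \<open>K\<close> that is trivial on the constants, namely \<open>ord\<^sub>P\<close>; so \<open>P f\<close> below
  is \<open>ord\<^sub>P(f)\<close>, and the local ring of \<open>C\<close> at \<open>P\<close> is the valuation ring. Since integers are used as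
  values, the (mathematically infinite) value at the zero function is fixed to be the dummy 0, in
  order to have each valuation represented only once.
\<close>

type_synonym point = "fn \<Rightarrow> int"

definition closed_points :: "fn ring \<Rightarrow> point set" where
  "closed_points K = {v.
     (\<forall>f \<in> carrier K - {\<zero>\<^bsub>K\<^esub>}. \<forall>h \<in> carrier K - {\<zero>\<^bsub>K\<^esub>}.
        v (f \<otimes>\<^bsub>K\<^esub> h) = v f + v h \<and>
        (f \<oplus>\<^bsub>K\<^esub> h \<noteq> \<zero>\<^bsub>K\<^esub> \<longrightarrow> min (v f) (v h) \<le> v (f \<oplus>\<^bsub>K\<^esub> h))) \<and>
     (\<forall>c. c \<noteq> 0 \<longrightarrow> v (const_fn c) = 0) \<and>
     (\<exists>t \<in> carrier K - {\<zero>\<^bsub>K\<^esub>}. v t = 1) \<and>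
     v \<zero>\<^bsub>K\<^esub> = 0}"

definition local_ring :: "fn ring \<Rightarrow> point \<Rightarrow> fn ring" where
  "local_ring K P = K \<lparr> carrier := {f \<in> carrier K. f = \<zero>\<^bsub>K\<^esub> \<or> P f \<ge> 0} \<rparr>"

definition max_ideal :: "fn ring \<Rightarrow> point \<Rightarrow> fn set" where
  "max_ideal K P = {f \<in> carrier K. f = \<zero>\<^bsub>K\<^esub> \<or> P f > 0}"

definition residue_field :: "fn ring \<Rightarrow> point \<Rightarrow> fn set ring" where
  "residue_field K P = local_ring K P Quot max_ideal K P"

definition residue_constants :: "fn ring \<Rightarrow> point \<Rightarrow> fn set set" where
  "residue_constants K P = range (\<lambda>c. max_ideal K P +>\<^bsub>local_ring K P\<^esub> const_fn c)"

definition point_degree :: "fn ring \<Rightarrow> point \<Rightarrow> nat" where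
  "point_degree K P =
     ring.dim (residue_field K P) (residue_constants K P) (carrier (residue_field K P))"

definition rational_points :: "fn ring \<Rightarrow> point set" where
  "rational_points K =
     {P \<in> closed_points K. carrier (residue_field K P) = residue_constants K P}"

definition has_value :: "fn ring \<Rightarrow> point \<Rightarrow> fn \<Rightarrow> rat \<Rightarrow> bool" where
  "has_value K P f c \<longleftrightarrow> f \<ominus>\<^bsub>K\<^esub> const_fn c \<in> max_ideal K P"

definition points_at_infinity :: "fn ring \<Rightarrow> point set" where
  "points_at_infinity K =
     {P \<in> closed_points K.
        \<not> (x_fn \<in> carrier (local_ring K P) \<and> y_fn \<in> carrier (local_ring K P))}"

text \<open>
  The closed points above the point \<open>(a, b)\<close> of the affine model; there is exactly one
  when \<open>(a, b)\<close> is a smooth point of the affine model.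
\<close>

definition points_over :: "fn ring \<Rightarrow> rat \<Rightarrow> rat \<Rightarrow> point set" where
  "points_over K a b = {P \<in> closed_points K. has_value K P x_fn a \<and> has_value K P y_fn b}"

section \<open>Divisors and the Picard group\<close>

definition Div :: "fn ring \<Rightarrow> (point \<Rightarrow>\<^sub>0 int) monoid" where
  "Div K = free_Abelian_group (closed_points K)"

definition divisor_degree :: "fn ring \<Rightarrow> (point \<Rightarrow>\<^sub>0 int) \<Rightarrow> int" where
  "divisor_degree K D =
     (\<Sum>P \<in> Poly_Mapping.keys D. Poly_Mapping.lookup D P * int (point_degree K P))"

definition is_div_of :: "fn ring \<Rightarrow> (point \<Rightarrow>\<^sub>0 int) \<Rightarrow> fn \<Rightarrow> bool" where
  "is_div_of K D h \<longleftrightarrow> (\<forall>P \<in> closed_points K. Poly_Mapping.lookup D P = P h)"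

definition principal_divisors :: "fn ring \<Rightarrow> (point \<Rightarrow>\<^sub>0 int) set" where
  "principal_divisors K =
     {D \<in> carrier (Div K). \<exists>h \<in> carrier K - {\<zero>\<^bsub>K\<^esub>}. is_div_of K D h}"

definition divisor_class :: "fn ring \<Rightarrow> (point \<Rightarrow>\<^sub>0 int) \<Rightarrow> (point \<Rightarrow>\<^sub>0 int) set" where
  "divisor_class K D = principal_divisors K #>\<^bsub>Div K\<^esub> D"

definition Pic :: "fn ring \<Rightarrow> (point \<Rightarrow>\<^sub>0 int) set monoid" where
  "Pic K = Div K Mod principal_divisors K"

definition Pic0 :: "fn ring \<Rightarrow> (point \<Rightarrow>\<^sub>0 int) set monoid" where
  "Pic0 K =
     Pic K \<lparr> carrier := divisor_class K ` {D \<in> carrier (Div K). divisor_degree K D = 0} \<rparr>"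

definition is_torsion :: "('a, 'b) monoid_scheme \<Rightarrow> 'a \<Rightarrow> bool" where
  "is_torsion G z \<longleftrightarrow> z \<in> carrier G \<and> (\<exists>n::nat. n \<ge> 1 \<and> z [^]\<^bsub>G\<^esub> n = \<one>\<^bsub>G\<^esub>)"

section \<open>Triples of points to which the torsion construction applies\<close>

text \<open>
  By definition, a triple of points defines an element \<open>{R\<^sub>1, R\<^sub>2, R\<^sub>3}\<close> of \<open>K\<^sub>2\<^sup>T(C)/torsion\<close>
  if the points are rational and distinct and their pairwise differences have torsion class
  in \<open>Pic\<^sup>0(C)\<close>.
\<close>

definition defines_K2T_element :: "fn ring \<Rightarrow> point \<Rightarrow> point \<Rightarrow> point \<Rightarrow> bool" where
  "defines_K2T_element K R\<^sub>1 R\<^sub>2 R\<^sub>3 \<longleftrightarrow>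
     {R\<^sub>1, R\<^sub>2, R\<^sub>3} \<subseteq> rational_points K \<and> distinct [R\<^sub>1, R\<^sub>2, R\<^sub>3] \<and>
     (\<forall>R \<in> {R\<^sub>1, R\<^sub>2, R\<^sub>3}. \<forall>S \<in> {R\<^sub>1, R\<^sub>2, R\<^sub>3}.
        is_torsion (Pic0 K) (divisor_class K (frag_of R - frag_of S)))"

end

theory Submission
  imports
    Defs
    "HOL-Computational_Algebra.Formal_Laurent_Series"
    "HOL-Computational_Algebra.Polynomial_FPS"
    "HOL-Computational_Algebra.Field_as_Ring"
    "HOL-Library.Product_Plus"
    "Subresultants.Subresultant_Gcd"
begin

text \<open>
  Put \<open>p = f\<^sub>1\<close>, \<open>q = x ^ (2 g + 2)\<close> and \<open>z = 2 y + p\<close>, so that \<open>z\<^sup>2 = D\<close> for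
  \<open>D = p\<^sup>2 - 4 q\<close>, a polynomial of odd degree \<open>2 g + 1\<close>. The interpolation conditions say that
  \<open>p(a\<^sub>i) = - 2 \<epsilon>\<^sub>i a\<^sub>i ^ (g + 1)\<close>, so at \<open>x = a\<^sub>i\<close> the quadratic equation for \<open>y\<close> has
  the double root \<open>\<epsilon>\<^sub>i a\<^sub>i ^ (g + 1)\<close>: the point \<open>P\<^sub>i\<close> is a branch point of the double cover \<open>x\<close>,
  and \<open>x - a\<^sub>i\<close> has divisor \<open>2 (P\<^sub>i) - 2 (\<infinity>)\<close>. The product of \<open>y\<close> with its conjugate
  \<open>- y - p\<close> is \<open>x ^ (2 g + 2)\<close>, and only \<open>y\<close> vanishes at \<open>O\<close> because \<open>p(0) \<noteq> 0\<close>; so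
  \<open>y\<close> has divisor \<open>(2 g + 2) ((O) - (\<infinity>))\<close>. Hence \<open>2 g + 2\<close> kills the class of every
  difference of two of the three points (\<open>order_y\<close>, \<open>order_x_minus_const\<close>,
  \<open>defines_K2T_elementI\<close>). The discriminant enters twice: the roots \<open>a\<^sub>i\<close> of \<open>D\<close> must be
  simple, and \<open>p(0) = 0\<close> would make \<open>0\<close> a double root.

  Closed points are normalised valuations of the function field, so the points named in the
  statement have to be constructed and shown to be unique.

  Existence: a pair of Laurent series \<open>(\<xi>, \<zeta>)\<close> with \<open>\<zeta>\<^sup>2 = D(\<xi>)\<close> and \<open>\<xi>\<close> nonconstant gives
  an embedding of the function field into the Laurent series over the rationals. Leading
  exponents then form a valuation, and constant coefficients show that its residue field is
  \<open>\<rat>\<close> (\<open>expansion_order_rational_point\<close>). At \<open>O\<close> one takes \<open>\<xi> = t\<close> and a square root of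
  \<open>D\<close>; at the branch points \<open>P\<^sub>i\<close> and \<open>\<infinity>\<close> one solves for \<open>\<xi>\<close> by inverting a power series.

  Uniqueness: for each of the points there is one function \<open>t\<close> such that every function has the
  form \<open>t ^ n u\<close>, where \<open>u\<close> is a unit at all valuations that could be the point
  (\<open>common_uniformizer\<close>). At a branch point the exponent is read off from \<open>\<alpha> + \<beta> z\<close>, whose
  two terms have orders of different parity; at \<open>O\<close> it is read off from the norm.
\<close>

section \<open>Evaluating rational functions at a nonconstant Laurent series\<close>

definition poly_at :: "rat fls \<Rightarrow> rat poly \<Rightarrow> rat fls" where
  "poly_at \<xi> P = poly (map_poly fls_const P) \<xi>"

lemma poly_at_pCons: "poly_at \<xi> (pCons c P) = fls_const c + \<xi> * poly_at \<xi> P"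
  by (cases "c = 0 \<and> P = 0") (auto simp: poly_at_def map_poly_pCons)

lemma poly_at_0 [simp]: "poly_at \<xi> 0 = 0"
  by (simp add: poly_at_def)

lemma poly_at_1 [simp]: "poly_at \<xi> 1 = 1"
  by (simp add: poly_at_def)

lemma poly_at_const [simp]: "poly_at \<xi> [:c:] = fls_const c"
  by (simp add: poly_at_pCons)

lemma poly_at_X [simp]: "poly_at \<xi> (pCons 0 1) = \<xi>"
  by (simp add: poly_at_pCons)

lemma poly_at_add: "poly_at \<xi> (P + Q) = poly_at \<xi> P + poly_at \<xi> Q"
  by (simp add: poly_at_def map_poly_add fls_plus_const)

lemma poly_at_smult: "poly_at \<xi> (smult c P) = fls_const c * poly_at \<xi> P"
  by (induction P)
    (simp_all add: poly_at_pCons ring_distribs mult_ac flip: fls_const_mult_const)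

lemma poly_at_mult: "poly_at \<xi> (P * Q) = poly_at \<xi> P * poly_at \<xi> Q"
  by (induction P)
    (simp_all add: poly_at_pCons poly_at_add poly_at_smult ring_distribs mult_ac)

lemma poly_at_power: "poly_at \<xi> (P ^ n) = poly_at \<xi> P ^ n"
  by (induction n) (simp_all add: poly_at_mult)

lemma poly_at_minus: "poly_at \<xi> (- P) = - poly_at \<xi> P"
  using poly_at_add[of \<xi> P "- P"] by (simp add: eq_neg_iff_add_eq_0 add.commute)

lemma poly_at_diff: "poly_at \<xi> (P - Q) = poly_at \<xi> P - poly_at \<xi> Q"
  using poly_at_add[of \<xi> P "- Q"] by (simp add: poly_at_minus)

lemma fls_deriv_poly_at: "fls_deriv (poly_at \<xi> P) = poly_at \<xi> (pderiv P) * fls_deriv \<xi>"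
  by (induction P) (simp_all add: poly_at_pCons pderiv_pCons poly_at_add ring_distribs mult_ac)

text \<open>
  A nonconstant series is transcendental over the constants: differentiating a polynomial relation
  and dividing by the derivative of the series gives a relation of smaller degree.
\<close>

lemma poly_at_nonzero:
  assumes "fls_deriv \<xi> \<noteq> 0" and "P \<noteq> 0"
  shows "poly_at \<xi> P \<noteq> 0"
  using assms(2)
proof (induction "degree P" arbitrary: P rule: less_induct)
  case less
  show ?case
  proof (cases "degree P = 0")
    case True
    then obtain c where "P = [:c:]"
      by (auto elim: degree_eq_zeroE)
    with less.prems show ?thesis
      by simp
  next
    case False
    then have "pderiv P \<noteq> 0" "degree (pderiv P) < degree P"
      by (simp_all add: pderiv_eq_0_iff degree_pderiv)
    then have "poly_at \<xi> (pderiv P) \<noteq> 0"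
      using less.hyps by blast
    then have "fls_deriv (poly_at \<xi> P) \<noteq> 0"
      using assms(1) by (simp add: fls_deriv_poly_at)
    then show ?thesis
      by auto
  qed
qed

text \<open>
  At a transcendental series the quotient does not depend on the fraction chosen, so the
  description below is a definite one.
\<close>

definition fract_at :: "rat fls \<Rightarrow> rat poly fract \<Rightarrow> rat fls" where
  "fract_at \<xi> F =
     (THE z. \<exists>P Q. Q \<noteq> 0 \<and> F = Fract P Q \<and> z = poly_at \<xi> P / poly_at \<xi> Q)"

locale nonconstant_series =
  fixes \<xi> :: "rat fls"
  assumes deriv_nonzero: "fls_deriv \<xi> \<noteq> 0"
begin

lemma poly_at_eq_0_iff [simp]: "poly_at \<xi> P = 0 \<longleftrightarrow> P = 0"
  using poly_at_nonzero[OF deriv_nonzero] by auto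

lemma fract_at_Fract:
  assumes "Q \<noteq> 0"
  shows "fract_at \<xi> (Fract P Q) = poly_at \<xi> P / poly_at \<xi> Q"
  unfolding fract_at_def
proof (rule the_equality)
  fix z assume "\<exists>P' Q'. Q' \<noteq> 0 \<and> Fract P Q = Fract P' Q' \<and> z = poly_at \<xi> P' / poly_at \<xi> Q'"
  then obtain P' Q' where "Q' \<noteq> 0" "P * Q' = P' * Q" "z = poly_at \<xi> P' / poly_at \<xi> Q'"
    using assms by (auto simp: eq_fract)
  moreover from this have "poly_at \<xi> P * poly_at \<xi> Q' = poly_at \<xi> P' * poly_at \<xi> Q"
    by (metis poly_at_mult)
  ultimately show "z = poly_at \<xi> P / poly_at \<xi> Q"
    using assms by (simp add: frac_eq_eq)
qed (use assms in blast)

lemma fract_at_to_fract [simp]: "fract_at \<xi> (to_fract P) = poly_at \<xi> P"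
  by (simp add: to_fract_def fract_at_Fract)

lemma fract_at_0 [simp]: "fract_at \<xi> 0 = 0"
  using fract_at_to_fract[of 0] by simp

lemma fract_at_1 [simp]: "fract_at \<xi> 1 = 1"
  using fract_at_to_fract[of 1] by simp

lemma fract_at_add: "fract_at \<xi> (F + G) = fract_at \<xi> F + fract_at \<xi> G"
proof -
  obtain P Q P' Q' where "F = Fract P Q" "Q \<noteq> 0" "G = Fract P' Q'" "Q' \<noteq> 0"
    by (metis Fract_cases)
  then show ?thesis
    by (simp add: fract_at_Fract poly_at_add poly_at_mult add_frac_eq)
qed

lemma fract_at_mult: "fract_at \<xi> (F * G) = fract_at \<xi> F * fract_at \<xi> G"
proof -
  obtain P Q P' Q' where "F = Fract P Q" "Q \<noteq> 0" "G = Fract P' Q'" "Q' \<noteq> 0"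
    by (metis Fract_cases)
  then show ?thesis
    by (simp add: fract_at_Fract poly_at_mult)
qed

lemma fract_at_minus: "fract_at \<xi> (- F) = - fract_at \<xi> F"
  using fract_at_add[of F "- F"] by (simp add: eq_neg_iff_add_eq_0 add.commute)

lemma fract_at_diff: "fract_at \<xi> (F - G) = fract_at \<xi> F - fract_at \<xi> G"
  using fract_at_add[of F "- G"] by (simp add: fract_at_minus)

end

text \<open>
  This turns evaluation at a series with constant term \<open>a\<close> into composition of power series, which
  is what compositional inverses speak about.
\<close>

lemma poly_at_translate:
  assumes "fps_nth \<sigma> 0 = 0"
  shows "poly_at (fps_to_fls (fps_const a + \<sigma>)) P =
           fps_to_fls (fps_of_poly (pcompose P [:a, 1:]) oo \<sigma>)"
proof (induction P)
  case 0
  then show ?case by simp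
next
  case (pCons c P)
  have lin: "fps_of_poly [:a, 1:] oo \<sigma> = fps_const a + \<sigma>"
    using assms by (simp add: fps_of_poly_pCons fps_compose_add_distrib)
  have "fps_of_poly (pcompose (pCons c P) [:a, 1:]) oo \<sigma> =
          fps_const c + (fps_const a + \<sigma>) * (fps_of_poly (pcompose P [:a, 1:]) oo \<sigma>)"
    by (simp add: pcompose_pCons fps_of_poly_add fps_of_poly_mult fps_compose_add_distrib
          lin[folded one_pCons] fps_of_poly_const
          fps_compose_mult_distrib[OF assms] del: mult_pCons_left)
  then show ?case
    unfolding poly_at_pCons pCons.IH
    by (simp only: fls_times_fps_to_fls fps_to_fls_plus fps_const_to_fls)
qed

section \<open>The function field\<close>

abbreviation ratfun :: "rat poly fract \<Rightarrow> fn" where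
  "ratfun F \<equiv> (F, 0)"

lemma Pair_eq_0 [simp]: "((A, B) :: fn) = 0 \<longleftrightarrow> A = 0 \<and> B = 0"
  by (simp add: zero_prod_def)

text \<open>
  The element \<open>z = 2 y + p\<close> completes the square: its square is the polynomial \<open>p\<^sup>2 - 4 q\<close>.
\<close>

definition root_fn :: "rat poly \<Rightarrow> fn" where
  "root_fn p = (to_fract p, 2)"

text \<open>
  Clear denominators in \<open>\<alpha>\<^sup>2 = D \<beta>\<^sup>2\<close> and compare the parities of the degrees.
\<close>

lemma odd_degree_not_square:
  fixes D :: "rat poly" and \<alpha> \<beta> :: "rat poly fract"
  assumes "odd (degree D)" and "\<alpha>\<^sup>2 = to_fract D * \<beta>\<^sup>2"
  shows "\<beta> = 0"
proof (rule ccontr)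
  assume "\<beta> \<noteq> 0"
  obtain P Q where \<alpha>: "\<alpha> = Fract P Q" "Q \<noteq> 0"
    by (metis Fract_cases)
  obtain P' Q' where \<beta>: "\<beta> = Fract P' Q'" "Q' \<noteq> 0"
    by (metis Fract_cases)
  have "P' \<noteq> 0"
    using \<open>\<beta> \<noteq> 0\<close> \<beta> by (auto simp: Zero_fract_def eq_fract)
  have "(P * Q')\<^sup>2 = D * (P' * Q)\<^sup>2"
    using assms(2) \<alpha> \<beta> by (simp add: power2_eq_square to_fract_def eq_fract mult_ac)
  moreover have "D \<noteq> 0"
    using assms(1) by auto
  ultimately have "P * Q' \<noteq> 0"
    using \<open>P' \<noteq> 0\<close> \<alpha>(2) by auto
  have "degree ((P * Q')\<^sup>2) = degree D + degree ((P' * Q)\<^sup>2)"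
    using \<open>(P * Q')\<^sup>2 = _\<close> \<open>D \<noteq> 0\<close> \<open>P' \<noteq> 0\<close> \<alpha>(2) by (simp add: degree_mult_eq)
  then have "2 * degree (P * Q') = degree D + 2 * degree (P' * Q)"
    using \<open>P * Q' \<noteq> 0\<close> \<open>P' \<noteq> 0\<close> \<alpha>(2) by (simp add: degree_power_eq)
  with assms(1) show False
    by presburger
qed

locale odd_hyperelliptic =
  fixes p q D :: "rat poly" and K :: "fn ring" (structure)
  defines "K \<equiv> function_field p q"
    and "D \<equiv> p\<^sup>2 - 4 * q"
  assumes odd_degree: "odd (degree D)"
begin

abbreviation z_fn :: fn where
  "z_fn \<equiv> root_fn p"

lemma D_nonzero: "D \<noteq> 0"
  using odd_degree by auto

lemma carrier_K [simp]: "carrier K = UNIV"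
  by (simp add: K_def function_field_def)

lemma zero_K [simp]: "\<zero> = 0"
  by (simp add: K_def function_field_def zero_prod_def)

lemma one_K: "\<one> = ratfun 1"
  by (simp add: K_def function_field_def)

lemma add_K [simp]: "f \<oplus> h = f + h"
  by (simp add: K_def function_field_def plus_prod_def split: prod.split)

lemma mult_Pair:
  "(A, B) \<otimes> (A', B') =
     (A * A' - to_fract q * B * B', A * B' + B * A' - to_fract p * B * B')"
  by (simp add: K_def function_field_def)

lemma ratfun_mult: "ratfun F \<otimes> (A, B) = (F * A, F * B)"
  by (simp add: mult_Pair)

lemma ratfun_mult_ratfun [simp]: "ratfun F \<otimes> ratfun G = ratfun (F * G)"
  by (simp add: mult_Pair)

lemma z_fn_square: "z_fn \<otimes> z_fn = ratfun (to_fract D)"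
proof -
  have [simp]: "to_fract (4 :: rat poly) = 4"
    by (metis to_fract_1 to_fract_add one_add_one numeral_Bit0)
  show ?thesis
    by (simp add: root_fn_def mult_Pair D_def power2_eq_square algebra_simps)
qed

text \<open>
  The nontrivial automorphism over the rational functions sends \<open>y\<close> to \<open>- y - p\<close>. The product of
  a function with its conjugate is a rational function, nonzero because \<open>D\<close> is not a square; this
  gives the inverses in the function field.
\<close>

lemma mult_conjugate:
  "(A, B) \<otimes> (A - to_fract p * B, - B) =
     ratfun (A\<^sup>2 - to_fract p * A * B + to_fract q * B\<^sup>2)"
  by (simp add: mult_Pair power2_eq_square algebra_simps)

lemma norm_eq_0_iff:
  "A\<^sup>2 - to_fract p * A * B + to_fract q * B\<^sup>2 = 0 \<longleftrightarrow> A = 0 \<and> B = 0"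
proof
  assume *: "A\<^sup>2 - to_fract p * A * B + to_fract q * B\<^sup>2 = 0"
  have four: "to_fract (4 :: rat poly) = 4"
    by (metis to_fract_1 to_fract_add one_add_one numeral_Bit0)
  have "(2 * A - to_fract p * B)\<^sup>2 - to_fract D * B\<^sup>2
          = 4 * (A\<^sup>2 - to_fract p * A * B + to_fract q * B\<^sup>2)"
    by (simp add: D_def four power2_eq_square algebra_simps)
  with * have "(2 * A - to_fract p * B)\<^sup>2 = to_fract D * B\<^sup>2"
    by simp
  then have "B = 0"
    using odd_degree_not_square[OF odd_degree] by blast
  with * show "A = 0 \<and> B = 0"
    by simp
qed auto

lemma field_K: "field K"
proof -
  interpret cring K
  proof (rule cringI)
    show "abelian_group K"
    proof (rule abelian_groupI)
      show "\<exists>h\<in>carrier K. h \<oplus> f = \<zero>" for f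
        by (rule bexI[of _ "- f"]) simp_all
    qed (simp_all add: add_ac)
    show "comm_monoid K"
      by (rule comm_monoidI) (auto simp: one_K mult_Pair algebra_simps)
  qed (auto simp: mult_Pair algebra_simps)
  show ?thesis
  proof (rule cring_fieldI2)
    show "\<zero> \<noteq> \<one>"
      by (simp add: one_K)
    fix f assume "f \<noteq> \<zero>"
    obtain A B where f: "f = (A, B)"
      by force
    let ?N = "A\<^sup>2 - to_fract p * A * B + to_fract q * B\<^sup>2"
    have "?N \<noteq> 0"
      using \<open>f \<noteq> \<zero>\<close> norm_eq_0_iff[of A B] f by auto
    have "f \<otimes> (ratfun (inverse ?N) \<otimes> (A - to_fract p * B, - B))
            = ratfun (inverse ?N) \<otimes> (f \<otimes> (A - to_fract p * B, - B))"
      by (simp add: m_lcomm)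
    also have "\<dots> = \<one>"
      using \<open>?N \<noteq> 0\<close> by (simp only: f mult_conjugate ratfun_mult_ratfun one_K) simp
    finally show "\<exists>h\<in>carrier K. f \<otimes> h = \<one>"
      unfolding carrier_K by blast
  qed
qed

sublocale field K
  by (rule field_K)

lemma minus_K [simp]: "f \<ominus> h = f - h"
proof -
  have "\<ominus> h = - h"
    by (rule minus_equality) simp_all
  then show ?thesis
    by (simp add: a_minus_def)
qed

lemma const_fn_nonzero: "c \<noteq> 0 \<Longrightarrow> const_fn c \<noteq> 0"
  by (simp add: const_fn_def)

lemma x_fn_nonzero: "x_fn \<noteq> 0"
  by (simp add: x_fn_def)

lemma y_fn_nonzero: "y_fn \<noteq> 0"
  by (simp add: y_fn_def)

lemma z_fn_nonzero: "z_fn \<noteq> 0"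
  by (simp add: root_fn_def)

lemma mult_eq_0_iff: "f \<otimes> h = 0 \<longleftrightarrow> f = 0 \<or> h = 0"
  using integral_iff[of f h] by simp

end

section \<open>Calculating with a closed point\<close>

text \<open>
  The value at the zero function being a dummy, lower bounds on the order are stated with this
  predicate, for which the zero function vanishes to every order.
\<close>

definition vanishes_to :: "point \<Rightarrow> int \<Rightarrow> fn \<Rightarrow> bool" where
  "vanishes_to v n f \<longleftrightarrow> f = 0 \<or> n \<le> v f"

lemma to_fract_power: "to_fract (P ^ n) = to_fract P ^ n"
  by (induction n) simp_all

abbreviation polyfun :: "rat poly \<Rightarrow> fn" where
  "polyfun P \<equiv> ratfun (to_fract P)"

lemma to_fract_two: "to_fract (2 :: rat poly) = 2"
  by (metis to_fract_1 to_fract_add one_add_one)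

lemma two_fract_nonzero: "(2 :: rat poly fract) \<noteq> 0"
  by (metis to_fract_two to_fract_eq_0_iff zero_neq_numeral)

lemma to_fract_minus_one: "to_fract [:- 1 :: rat:] = - 1"
proof -
  have "[:- 1 :: rat:] = - 1"
    by (simp only: one_pCons minus_pCons minus_zero)
  then show ?thesis
    by (simp only: to_fract_uminus to_fract_1)
qed

lemma const_fn_2: "const_fn 2 = ratfun 2"
  by (simp add: const_fn_def to_fract_two flip: numeral_poly)

lemma const_fn_0: "const_fn 0 = 0"
  by (simp add: const_fn_def)

context odd_hyperelliptic
begin

lemma point_mult:
  assumes "v \<in> closed_points K" "f \<noteq> 0" "h \<noteq> 0"
  shows "v (f \<otimes> h) = v f + v h"
  using assms by (simp add: closed_points_def)

lemma point_const: "v \<in> closed_points K \<Longrightarrow> c \<noteq> 0 \<Longrightarrow> v (const_fn c) = 0"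
  by (simp add: closed_points_def)

lemma point_0: "v \<in> closed_points K \<Longrightarrow> v 0 = 0"
  by (simp add: closed_points_def)

lemma point_one: "v \<in> closed_points K \<Longrightarrow> v \<one> = 0"
  using point_const[of v 1] by (simp add: const_fn_def one_K flip: one_pCons)

lemma inv_nonzero: "f \<noteq> 0 \<Longrightarrow> inv f \<noteq> 0"
  using field_Units Units_inv_Units[of f] by simp

lemma point_inv:
  assumes "v \<in> closed_points K" "f \<noteq> 0"
  shows "v (inv f) = - v f"
proof -
  have "f \<in> Units K"
    using assms field_Units by simp
  then have "f \<otimes> inv f = \<one>" "inv f \<noteq> 0"
    using inv_nonzero[OF assms(2)] by auto
  then show ?thesis
    using point_mult[OF assms, of "inv f"] point_one[OF assms(1)] by simp
qed

lemma pow_nonzero: "f \<noteq> 0 \<Longrightarrow> f [^] (n :: nat) \<noteq> 0"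
  by (induction n) (auto simp: mult_eq_0_iff one_K)

lemma point_pow:
  assumes "v \<in> closed_points K" "f \<noteq> 0"
  shows "v (f [^] (n :: nat)) = int n * v f"
  using assms
  by (induction n) (auto simp: point_one point_mult pow_nonzero algebra_simps)

lemma ratfun_power: "ratfun F [^] (n :: nat) = ratfun (F ^ n)"
  by (induction n) (simp_all add: one_K mult.commute)

lemma vanishes_to_add:
  assumes "v \<in> closed_points K" "vanishes_to v n f" "vanishes_to v n h"
  shows "vanishes_to v n (f + h)"
proof (cases "f = 0 \<or> h = 0 \<or> f + h = 0")
  case False
  then have "min (v f) (v h) \<le> v (f + h)"
    using assms(1) by (simp add: closed_points_def)
  with False assms(2,3) show ?thesis
    by (auto simp: vanishes_to_def)
qed (use assms in \<open>auto simp: vanishes_to_def\<close>)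

lemma vanishes_to_mult:
  assumes "v \<in> closed_points K" "vanishes_to v n f" "vanishes_to v m h"
  shows "vanishes_to v (n + m) (f \<otimes> h)"
  using assms by (cases "f = 0 \<or> h = 0") (auto simp: vanishes_to_def point_mult mult_eq_0_iff)

lemma vanishes_to_mono: "vanishes_to v n f \<Longrightarrow> m \<le> n \<Longrightarrow> vanishes_to v m f"
  by (auto simp: vanishes_to_def)

lemma vanishes_to_const: "v \<in> closed_points K \<Longrightarrow> vanishes_to v 0 (const_fn c)"
  by (cases "c = 0") (simp_all add: vanishes_to_def point_const, simp add: const_fn_def)

lemma minus_conv_mult: "- f = const_fn (- 1) \<otimes> f"
proof -
  show ?thesis
    by (cases f) (simp add: const_fn_def ratfun_mult to_fract_minus_one)
qed

lemma point_minus: "v \<in> closed_points K \<Longrightarrow> v (- f) = v f"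
  by (cases "f = 0") (simp_all add: minus_conv_mult[of f] point_mult point_const const_fn_nonzero)

lemma vanishes_to_minus: "v \<in> closed_points K \<Longrightarrow> vanishes_to v n f \<Longrightarrow> vanishes_to v n (- f)"
  by (auto simp: vanishes_to_def point_minus)

lemma vanishes_to_diff:
  assumes "v \<in> closed_points K" "vanishes_to v n f" "vanishes_to v n h"
  shows "vanishes_to v n (f - h)"
  using vanishes_to_add[OF assms(1,2) vanishes_to_minus[OF assms(1,3)]] by simp

text \<open>
  If \<open>f + h\<close> vanished to higher order than \<open>f\<close>, then so would \<open>f = (f + h) - h\<close>.
\<close>

lemma point_add_dominant:
  assumes "v \<in> closed_points K" "f \<noteq> 0" "vanishes_to v (v f + 1) h"
  shows "f + h \<noteq> 0" "v (f + h) = v f"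
proof -
  have lower: "\<not> vanishes_to v (v f + 1) (f + h)"
  proof
    assume "vanishes_to v (v f + 1) (f + h)"
    then have "vanishes_to v (v f + 1) (f + h - h)"
      using assms by (intro vanishes_to_diff)
    with assms(2) show False
      by (simp add: vanishes_to_def)
  qed
  then show "f + h \<noteq> 0"
    by (auto simp: vanishes_to_def)
  have "vanishes_to v (v f) (f + h)"
    using assms by (intro vanishes_to_add) (auto simp: vanishes_to_def)
  with lower \<open>f + h \<noteq> 0\<close> show "v (f + h) = v f"
    by (auto simp: vanishes_to_def)
qed

lemma max_ideal_iff: "f \<in> max_ideal K v \<longleftrightarrow> vanishes_to v 1 f"
  by (auto simp: max_ideal_def vanishes_to_def)

lemma local_ring_iff: "f \<in> carrier (local_ring K v) \<longleftrightarrow> vanishes_to v 0 f"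
  by (auto simp: local_ring_def vanishes_to_def)

lemma has_value_iff: "has_value K v f c \<longleftrightarrow> vanishes_to v 1 (f - const_fn c)"
  by (simp add: has_value_def max_ideal_iff)

subsection \<open>Polynomials in \<open>x\<close>\<close>

lemma polyfun_pCons: "polyfun (pCons c P) = const_fn c + x_fn \<otimes> polyfun P"
proof -
  have "pCons c P = [:c:] + [:0, 1:] * P"
    by simp
  then have "to_fract (pCons c P) = to_fract [:c:] + to_fract [:0, 1:] * to_fract P"
    by (metis to_fract_add to_fract_mult)
  then show ?thesis
    by (simp add: const_fn_def x_fn_def)
qed

lemma polyfun_eq_0_iff [simp]: "polyfun P = 0 \<longleftrightarrow> P = 0"
  by (simp add:)

lemma x_minus_const: "x_fn - const_fn a = polyfun [:- a, 1:]"
proof -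
  have "[:- a, 1:] = [:0, 1:] - [:a:]"
    by simp
  then have "to_fract [:- a, 1:] = to_fract [:0, 1:] - to_fract [:a:]"
    by (metis to_fract_diff)
  then show ?thesis
    by (simp add: const_fn_def x_fn_def)
qed

lemma polynomial_regular:
  assumes "v \<in> closed_points K" "vanishes_to v 0 x_fn"
  shows "vanishes_to v 0 (polyfun P)"
proof (induction P)
  case 0
  then show ?case
    by (simp add: vanishes_to_def)
next
  case (pCons c P)
  then have "vanishes_to v (0 + 0) (x_fn \<otimes> polyfun P)"
    using assms by (intro vanishes_to_mult)
  then show ?case
    unfolding polyfun_pCons using assms by (intro vanishes_to_add vanishes_to_const) simp_all
qed

text \<open>
  At a pole of \<open>x\<close> the leading term of a polynomial dominates, by induction along Horner's scheme.
\<close>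

lemma polynomial_pole_order:
  assumes v: "v \<in> closed_points K" "v x_fn < 0" and "P \<noteq> 0"
  shows "v (polyfun P) = int (degree P) * v x_fn"
  using assms(3)
proof (induction P)
  case 0
  then show ?case by simp
next
  case (pCons c P)
  show ?case
  proof (cases "P = 0")
    case True
    with pCons.hyps show ?thesis
      using point_const[OF v(1), of c] by (simp add: const_fn_def)
  next
    case False
    then have nz: "polyfun P \<noteq> 0"
      by simp
    then have nz': "x_fn \<otimes> polyfun P \<noteq> 0"
      by (simp only: mult_eq_0_iff x_fn_nonzero simp_thms)
    have "v (x_fn \<otimes> polyfun P) = v x_fn + int (degree P) * v x_fn"
      by (simp only: point_mult[OF v(1) x_fn_nonzero nz] pCons.IH[OF False])
    then have val: "v (x_fn \<otimes> polyfun P) = int (Suc (degree P)) * v x_fn"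
      by (simp add: algebra_simps)
    then have "v (x_fn \<otimes> polyfun P) + 1 \<le> 0"
      using v(2) mult_pos_neg[of "int (Suc (degree P))" "v x_fn"] by linarith
    then have "vanishes_to v (v (x_fn \<otimes> polyfun P) + 1) (const_fn c)"
      by (rule vanishes_to_mono[OF vanishes_to_const[OF v(1)]])
    from point_add_dominant(2)[OF v(1) nz' this]
    have "v (polyfun (pCons c P)) = v (x_fn \<otimes> polyfun P)"
      by (simp only: polyfun_pCons add.commute)
    with val False show ?thesis
      by simp
  qed
qed

lemma regular_at_x_value:
  assumes "v \<in> closed_points K" "vanishes_to v 1 (x_fn - const_fn a)"
  shows "vanishes_to v 0 x_fn"
proof -
  have "vanishes_to v 0 (x_fn - const_fn a + const_fn a)"
    using assms by (intro vanishes_to_add vanishes_to_const) (auto elim: vanishes_to_mono)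
  then show ?thesis
    by simp
qed

text \<open>
  Split off the power of \<open>x - a\<close>; the cofactor is a nonzero constant plus a multiple of
  \<open>x - a\<close>, hence a unit.
\<close>

lemma polynomial_vanishing_order:
  assumes v: "v \<in> closed_points K" "vanishes_to v 1 (x_fn - const_fn a)" and "P \<noteq> 0"
  shows "v (polyfun P) = int (order a P) * v (x_fn - const_fn a)"
proof -
  obtain Q where P: "P = [:- a, 1:] ^ order a P * Q" and ndvd: "\<not> [:- a, 1:] dvd Q"
    using order_decomp[OF \<open>P \<noteq> 0\<close>] by blast
  have "poly Q a \<noteq> 0" "Q \<noteq> 0"
    using ndvd by (auto simp: poly_eq_0_iff_dvd)
  have "[:- a, 1:] dvd Q - [:poly Q a:]"
    by (subst poly_eq_0_iff_dvd[symmetric]) simp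
  then obtain R where "Q - [:poly Q a:] = [:- a, 1:] * R"
    by (rule dvdE)
  then have R: "Q = [:- a, 1:] * R + [:poly Q a:]"
    by (simp only: diff_eq_eq)
  let ?c = "const_fn (poly Q a)" and ?h = "polyfun [:- a, 1:] \<otimes> polyfun R"
  have c: "?c \<noteq> 0" "v ?c = 0"
    by (rule const_fn_nonzero[OF \<open>poly Q a \<noteq> 0\<close>], rule point_const[OF v(1) \<open>poly Q a \<noteq> 0\<close>])
  have "vanishes_to v (1 + 0) ?h"
    by (rule vanishes_to_mult[OF v(1) v(2)[unfolded x_minus_const]
          polynomial_regular[OF v(1) regular_at_x_value[OF v]]])
  then have "vanishes_to v (v ?c + 1) ?h"
    unfolding c(2) by (simp only: add.commute)
  then have "v (?c + ?h) = 0"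
    using point_add_dominant(2)[OF v(1) c(1)] c(2) by metis
  moreover have "polyfun Q = ?c + ?h"
  proof -
    have "to_fract Q = to_fract [:- a, 1:] * to_fract R + to_fract [:poly Q a:]"
      using arg_cong[OF R, of to_fract] by (simp only: to_fract_add to_fract_mult)
    then show ?thesis
      by (simp only: const_fn_def ratfun_mult_ratfun add_Pair add_0 add.commute)
  qed
  ultimately have "v (polyfun Q) = 0"
    by metis
  have nz: "polyfun [:- a, 1:] \<noteq> 0" "polyfun Q \<noteq> 0"
    using \<open>Q \<noteq> 0\<close> by simp_all
  have "to_fract P = to_fract ([:- a, 1:] ^ order a P * Q)"
    by (rule arg_cong[OF P])
  then have "polyfun P = polyfun [:- a, 1:] [^] order a P \<otimes> polyfun Q"
    unfolding ratfun_power ratfun_mult_ratfun to_fract_mult to_fract_power by (rule arg_cong)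
  moreover have "v (polyfun [:- a, 1:] [^] order a P \<otimes> polyfun Q)
                   = int (order a P) * v (polyfun [:- a, 1:]) + v (polyfun Q)"
    by (simp only: point_mult[OF v(1) pow_nonzero[OF nz(1)] nz(2)] point_pow[OF v(1) nz(1)])
  ultimately show ?thesis
    unfolding x_minus_const using \<open>v (polyfun Q) = 0\<close> by simp
qed

subsection \<open>Regularity of \<open>y\<close>\<close>

lemma y_fn_square: "y_fn \<otimes> y_fn = - polyfun q - polyfun p \<otimes> y_fn"
  by (simp only: y_fn_def mult_Pair) simp

text \<open>
  \<open>y\<close> is integral over the polynomials in \<open>x\<close>: at a pole of \<open>y\<close> the term \<open>y\<^sup>2\<close> of its
  equation would dominate the others. Therefore the points at infinity are the poles of \<open>x\<close>.
\<close>

lemma y_regular: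
  assumes v: "v \<in> closed_points K" "vanishes_to v 0 x_fn"
  shows "vanishes_to v 0 y_fn"
proof (rule ccontr)
  assume "\<not> vanishes_to v 0 y_fn"
  then have neg: "v y_fn < 0"
    by (auto simp: vanishes_to_def)
  have "vanishes_to v (0 + v y_fn) (polyfun p \<otimes> y_fn)"
    by (rule vanishes_to_mult[OF v(1) polynomial_regular[OF v]]) (simp add: vanishes_to_def)
  then have "vanishes_to v (v y_fn) (polyfun p \<otimes> y_fn)"
    by simp
  moreover have "vanishes_to v (v y_fn) (- polyfun q)"
    by (rule vanishes_to_minus[OF v(1) vanishes_to_mono[OF polynomial_regular[OF v]]])
      (use neg in simp)
  ultimately have "vanishes_to v (v y_fn) (y_fn \<otimes> y_fn)"
    unfolding y_fn_square by (intro vanishes_to_diff[OF v(1)])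
  moreover have "v (y_fn \<otimes> y_fn) = 2 * v y_fn" "y_fn \<otimes> y_fn \<noteq> 0"
    using y_fn_nonzero by (simp_all add: point_mult[OF v(1)] mult_eq_0_iff)
  ultimately show False
    using neg by (simp only: vanishes_to_def) linarith
qed

lemma points_at_infinity_eq: "points_at_infinity K = {v \<in> closed_points K. v x_fn < 0}"
proof -
  have "vanishes_to v 0 x_fn \<and> vanishes_to v 0 y_fn \<longleftrightarrow> \<not> v x_fn < 0" if "v \<in> closed_points K" for v
    using y_regular[OF that] by (auto simp: vanishes_to_def x_fn_nonzero)
  then show ?thesis
    by (auto simp: points_at_infinity_def local_ring_iff)
qed

end

section \<open>Uniqueness of points\<close>

context odd_hyperelliptic
begin

text \<open>
  If every function is, up to a unit at all the points of \<open>S\<close>, a power of one function \<open>t\<close>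
  vanishing at them, then each valuation in \<open>S\<close> is determined by its value at \<open>t\<close>, and this value
  divides all values of a normalised valuation.
\<close>

lemma common_uniformizer:
  assumes S: "S \<subseteq> closed_points K"
    and pos: "\<forall>v\<in>S. 0 < v t"
    and power: "\<forall>f. f \<noteq> 0 \<longrightarrow> (\<exists>n. \<forall>v\<in>S. v f = n * v t)"
  shows "v \<in> S \<Longrightarrow> v t = 1" and "v \<in> S \<Longrightarrow> v' \<in> S \<Longrightarrow> v = v'"
proof -
  show one: "v t = 1" if "v \<in> S" for v
  proof -
    have "v \<in> closed_points K"
      using that S by blast
    then obtain s where "s \<in> carrier K - {\<zero>}" "v s = 1"
      unfolding closed_points_def by blast
    then have "s \<noteq> 0"
      by simp
    with power obtain n where "\<forall>w\<in>S. w s = n * w t"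
      by blast
    with \<open>v s = 1\<close> that have "v t * n = 1"
      by (simp add: Groups.mult.commute)
    with pos that show ?thesis
      by (simp add: pos_zmult_eq_1_iff)
  qed
  show "v = v'" if "v \<in> S" "v' \<in> S"
  proof
    fix f show "v f = v' f"
    proof (cases "f = 0")
      case True
      with point_0[OF subsetD[OF S that(1)]] point_0[OF subsetD[OF S that(2)]] show ?thesis
        by simp
    next
      case False
      with power obtain n where "\<forall>w\<in>S. w f = n * w t"
        by blast
      with one[OF that(1)] one[OF that(2)] that show ?thesis
        by (metis mult_1_right)
    qed
  qed
qed

lemma ratfun_power_from_polynomials:
  assumes S: "S \<subseteq> closed_points K"
    and power: "\<And>P. P \<noteq> 0 \<Longrightarrow> \<exists>n :: int. \<forall>v\<in>S. v (polyfun P) = n * e v"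
    and "F \<noteq> 0"
  shows "\<exists>n :: int. \<forall>v\<in>S. v (ratfun F) = n * e v"
proof -
  obtain P Q where F: "F = Fract P Q" "Q \<noteq> 0"
    by (metis Fract_cases)
  then have eq: "ratfun F \<otimes> polyfun Q = polyfun P"
    by (simp add: Fract_conv_to_fract)
  have "P \<noteq> 0"
    using F \<open>F \<noteq> 0\<close> by (auto simp: Fract_conv_to_fract)
  obtain m n where mn: "\<forall>v\<in>S. v (polyfun P) = m * e v" "\<forall>v\<in>S. v (polyfun Q) = n * e v"
    using power[OF \<open>P \<noteq> 0\<close>] power[OF \<open>Q \<noteq> 0\<close>] by blast
  have "v (ratfun F) = (m - n) * e v" if "v \<in> S" for v
  proof -
    have "v (ratfun F) + v (polyfun Q) = v (polyfun P)"
      using point_mult[OF subsetD[OF S that], of "ratfun F" "polyfun Q"] \<open>F \<noteq> 0\<close> \<open>Q \<noteq> 0\<close>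
      unfolding eq by simp
    with mn(1)[rule_format, OF that] mn(2)[rule_format, OF that] show ?thesis
      by (simp only: left_diff_distrib eq_diff_eq)
  qed
  then show ?thesis
    by blast
qed

text \<open>
  At a branch point the rational functions of \<open>x\<close> have even order and \<open>z\<close> has odd order, in terms
  of a uniformizer. Hence no cancellation can occur in \<open>\<alpha> + \<beta> z\<close>.
\<close>

lemma branch_power:
  assumes S: "S \<subseteq> closed_points K"
    and pos: "\<And>v. v \<in> S \<Longrightarrow> 0 < v t"
    and z: "odd m" "\<And>v. v \<in> S \<Longrightarrow> v z_fn = m * v t"
    and even: "\<And>P. P \<noteq> 0 \<Longrightarrow> \<exists>n. \<forall>v\<in>S. v (polyfun P) = n * (2 * v t)"
    and "f \<noteq> 0"
  shows "\<exists>n. \<forall>v\<in>S. v f = n * v t"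
proof -
  obtain A B where f: "f = (A, B)"
    by force
  define \<alpha> \<beta> where "\<alpha> = A - to_fract p * B / 2" and "\<beta> = B / 2"
  have f_eq: "f = ratfun \<alpha> + ratfun \<beta> \<otimes> z_fn"
    using two_fract_nonzero by (simp add: f \<alpha>_def \<beta>_def root_fn_def ratfun_mult mult.commute)
  note ev = ratfun_power_from_polynomials[OF S even]
  have beta: "\<exists>n. odd n \<and> (\<forall>v\<in>S. v (ratfun \<beta> \<otimes> z_fn) = n * v t)" if "\<beta> \<noteq> 0"
  proof -
    obtain n where n: "\<forall>v\<in>S. v (ratfun \<beta>) = n * (2 * v t)"
      using ev[OF _ \<open>\<beta> \<noteq> 0\<close>] by blast
    have "v (ratfun \<beta> \<otimes> z_fn) = (2 * n + m) * v t" if v: "v \<in> S" for v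
      using point_mult[OF subsetD[OF S v] _ z_fn_nonzero, of "ratfun \<beta>"] \<open>\<beta> \<noteq> 0\<close>
        n[rule_format, OF v] z(2)[OF v]
      by (simp add: algebra_simps)
    with \<open>odd m\<close> show ?thesis
      by (intro exI[of _ "2 * n + m"]) auto
  qed
  consider "\<alpha> = 0" "\<beta> \<noteq> 0" | "\<alpha> \<noteq> 0" "\<beta> = 0" | "\<alpha> \<noteq> 0" "\<beta> \<noteq> 0"
    using \<open>f \<noteq> 0\<close> f_eq by (cases "\<alpha> = 0"; cases "\<beta> = 0") (simp_all add: ratfun_mult root_fn_def)
  then show ?thesis
  proof cases
    case 1
    then have "f = ratfun \<beta> \<otimes> z_fn"
      using f_eq by (metis add_0 zero_prod_def)
    with beta[OF 1(2)] show ?thesis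
      by blast
  next
    case 2
    then obtain n where n: "\<forall>v\<in>S. v (ratfun \<alpha>) = n * (2 * v t)"
      using ev by blast
    have "f = ratfun \<alpha>"
      using 2 f_eq by (simp add: ratfun_mult root_fn_def)
    then have "v f = 2 * n * v t" if "v \<in> S" for v
      using n[rule_format, OF that] by (simp add: mult_ac)
    then show ?thesis
      by blast
  next
    case 3
    then obtain k where k: "\<forall>v\<in>S. v (ratfun \<alpha>) = k * (2 * v t)"
      using ev by blast
    from 3 beta obtain n where n: "odd n" "\<forall>v\<in>S. v (ratfun \<beta> \<otimes> z_fn) = n * v t"
      by blast
    have nz: "ratfun \<alpha> \<noteq> 0" "ratfun \<beta> \<otimes> z_fn \<noteq> 0"
      using 3 by (auto simp: mult_eq_0_iff z_fn_nonzero)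
    have "n \<noteq> 2 * k"
      using n(1) by auto
    have "v f = min (2 * k) n * v t" if v: "v \<in> S" for v
    proof -
      note v' = subsetD[OF S v] and k' = k[rule_format, OF v] and n' = n(2)[rule_format, OF v]
      show ?thesis
      proof (cases "2 * k < n")
        case True
        then have "v (ratfun \<alpha>) + 1 \<le> v (ratfun \<beta> \<otimes> z_fn)"
          unfolding k' n' using mult_strict_right_mono[OF True pos[OF v]] by (simp add: mult_ac)
        then have "v f = v (ratfun \<alpha>)"
          unfolding f_eq by (intro point_add_dominant(2)[OF v' nz(1)]) (simp add: vanishes_to_def)
        with k' True show ?thesis
          by (simp add: mult_ac)
      next
        case False
        with \<open>n \<noteq> 2 * k\<close> have less: "n < 2 * k"
          by simp
        have "v (ratfun \<beta> \<otimes> z_fn) + 1 \<le> v (ratfun \<alpha>)"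
          unfolding k' n' using mult_strict_right_mono[OF less pos[OF v]] by (simp add: mult_ac)
        then have "v f = v (ratfun \<beta> \<otimes> z_fn)"
          unfolding f_eq Groups.add.commute[of "ratfun \<alpha>"]
          by (intro point_add_dominant(2)[OF v' nz(2)]) (simp add: vanishes_to_def)
        with n' less show ?thesis
          by simp
      qed
    qed
    then show ?thesis
      by blast
  qed
qed

lemma z_fn_order:
  assumes "v \<in> closed_points K"
  shows "2 * v z_fn = v (polyfun D)"
  using point_mult[OF assms z_fn_nonzero z_fn_nonzero] by (simp add: z_fn_square)

text \<open>
  From \<open>z\<^sup>2 = D\<close> and \<open>deg D = 2 k + 1\<close>, at infinity the order of \<open>x\<close> is \<open>- 2 m\<close> and that of
  \<open>z\<close> is \<open>- (2 k + 1) m\<close> for some \<open>m > 0\<close>. The monomial \<open>z / x ^ (k + 1)\<close> has order \<open>m\<close>.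
\<close>

definition infinity_uniformizer :: fn where
  "infinity_uniformizer = inv (x_fn [^] (Suc (degree D div 2))) \<otimes> z_fn"

lemma order_infinity_uniformizer:
  assumes v: "v \<in> closed_points K" "v x_fn < 0"
  shows "v x_fn = - (2 * v infinity_uniformizer)"
    and "v z_fn = - int (degree D) * v infinity_uniformizer"
proof -
  obtain k where k: "degree D = 2 * k + 1"
    using odd_degree by (rule oddE)
  have z: "2 * v z_fn = (2 * int k + 1) * v x_fn"
    using z_fn_order[OF v(1)] polynomial_pole_order[OF v D_nonzero] by (simp add: k)
  have nz: "x_fn [^] Suc k \<noteq> 0"
    by (rule pow_nonzero[OF x_fn_nonzero])
  have "infinity_uniformizer = inv (x_fn [^] Suc k) \<otimes> z_fn"
    by (simp add: infinity_uniformizer_def k)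
  then have t: "v infinity_uniformizer = v z_fn - int (Suc k) * v x_fn"
    using point_mult[OF v(1) inv_nonzero[OF nz] z_fn_nonzero]
    by (simp only: point_inv[OF v(1) nz] point_pow[OF v(1) x_fn_nonzero])
  show x: "v x_fn = - (2 * v infinity_uniformizer)"
    using z t by (simp add: algebra_simps)
  have "v z_fn = v infinity_uniformizer + int (Suc k) * (- (2 * v infinity_uniformizer))"
    using t unfolding x by linarith
  then show "v z_fn = - int (degree D) * v infinity_uniformizer"
    by (simp add: k algebra_simps)
qed

lemma infinity_unique:
  assumes "v \<in> points_at_infinity K"
  shows "v infinity_uniformizer = 1"
    and "v' \<in> points_at_infinity K \<Longrightarrow> v = v'"
proof -
  let ?S = "points_at_infinity K" and ?t = infinity_uniformizer
  have S: "?S \<subseteq> closed_points K"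
    by (auto simp: points_at_infinity_eq)
  have pos: "0 < w ?t" if "w \<in> ?S" for w
    using that order_infinity_uniformizer(1)[of w] by (auto simp: points_at_infinity_eq)
  have power: "\<exists>n. \<forall>w\<in>?S. w f = n * w ?t" if f: "f \<noteq> 0" for f
  proof (rule branch_power[OF S pos _ _ _ f])
    show "odd (- int (degree D))"
      using odd_degree by simp
    show "w z_fn = - int (degree D) * w ?t" if "w \<in> ?S" for w
      using that order_infinity_uniformizer by (auto simp: points_at_infinity_eq)
    fix P :: "rat poly" assume "P \<noteq> 0"
    then have "w (polyfun P) = - int (degree P) * (2 * w ?t)" if "w \<in> ?S" for w
      using that polynomial_pole_order[of w P] order_infinity_uniformizer(1)[of w]
      by (auto simp: points_at_infinity_eq)
    then show "\<exists>n. \<forall>w\<in>?S. w (polyfun P) = n * (2 * w ?t)"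
      by blast
  qed
  have "\<forall>w\<in>?S. 0 < w ?t" "\<forall>f. f \<noteq> 0 \<longrightarrow> (\<exists>n. \<forall>w\<in>?S. w f = n * w ?t)"
    using pos power by blast+
  note unique = common_uniformizer[OF S this]
  show "v ?t = 1"
    by (rule unique(1)[OF assms])
  show "v = v'" if "v' \<in> ?S"
    by (rule unique(2)[OF assms that])
qed

text \<open>
  At a simple root \<open>a\<close> of \<open>D\<close> the relation \<open>z\<^sup>2 = D\<close> shows that \<open>x - a\<close> has twice the order
  of \<open>z\<close>, so \<open>z\<close> is a uniformizer.
\<close>

lemma finite_branch_point_unique:
  assumes "order a D = 1"
    and v: "v \<in> closed_points K" "vanishes_to v 1 (x_fn - const_fn a)"
  shows "v z_fn = 1" and "v (x_fn - const_fn a) = 2"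
    and "v' \<in> closed_points K \<Longrightarrow> vanishes_to v' 1 (x_fn - const_fn a) \<Longrightarrow> v = v'"
proof -
  let ?S = "{v \<in> closed_points K. vanishes_to v 1 (x_fn - const_fn a)}"
  have S: "?S \<subseteq> closed_points K"
    by blast
  have z: "w (x_fn - const_fn a) = 2 * w z_fn" if "w \<in> ?S" for w
  proof -
    from that have w: "w \<in> closed_points K" "vanishes_to w 1 (x_fn - const_fn a)"
      by blast+
    show ?thesis
      using z_fn_order[OF w(1)] polynomial_vanishing_order[OF w D_nonzero] assms(1) by simp
  qed
  have pos: "0 < w z_fn" if "w \<in> ?S" for w
    using that z[OF that] by (auto simp: vanishes_to_def x_minus_const)
  have power: "\<exists>n. \<forall>w\<in>?S. w f = n * w z_fn" if f: "f \<noteq> 0" for f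
  proof (rule branch_power[OF S pos _ _ _ f])
    show "odd (1 :: int)"
      by simp
    show "w z_fn = 1 * w z_fn" if "w \<in> ?S" for w
      by simp
    fix P :: "rat poly" assume "P \<noteq> 0"
    then have "w (polyfun P) = int (order a P) * (2 * w z_fn)" if "w \<in> ?S" for w
      using that polynomial_vanishing_order[of w a P] z[OF that] by auto
    then show "\<exists>n. \<forall>w\<in>?S. w (polyfun P) = n * (2 * w z_fn)"
      by blast
  qed
  have "\<forall>w\<in>?S. 0 < w z_fn" "\<forall>f. f \<noteq> 0 \<longrightarrow> (\<exists>n. \<forall>w\<in>?S. w f = n * w z_fn)"
    using pos power by blast+
  note unique = common_uniformizer[OF S this]
  have vS: "v \<in> ?S"
    using v by simp
  show "v z_fn = 1"
    by (rule unique(1)[OF vS])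
  with z[OF vS] show "v (x_fn - const_fn a) = 2"
    by simp
  show "v = v'" if "v' \<in> closed_points K" "vanishes_to v' 1 (x_fn - const_fn a)"
    by (rule unique(2)[OF vS]) (use that in simp)
qed

text \<open>
  Clearing denominators and dividing by a greatest common divisor leaves \<open>P + Q y\<close> with \<open>P\<close>
  and \<open>Q\<close> not both vanishing at any given \<open>x\<close>.
\<close>

lemma primitive_form:
  assumes "f \<noteq> 0"
  obtains F P Q where "F \<noteq> 0" "f = ratfun F \<otimes> (to_fract P, to_fract Q)" "coprime P Q"
proof -
  obtain A B where f: "f = (A, B)"
    by force
  obtain P1 Q1 where A: "A = to_fract P1 / to_fract Q1" "Q1 \<noteq> 0"
    by (metis Fract_cases Fract_conv_to_fract)
  obtain P2 Q2 where B: "B = to_fract P2 / to_fract Q2" "Q2 \<noteq> 0"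
    by (metis Fract_cases Fract_conv_to_fract)
  have "P1 * Q2 \<noteq> 0 \<or> P2 * Q1 \<noteq> 0"
    using A B \<open>f \<noteq> 0\<close> f by auto
  then have "gcd (P1 * Q2) (P2 * Q1) \<noteq> 0"
    by simp
  from gcd_coprime_exists[OF this] obtain P Q where PQ:
    "P1 * Q2 = P * gcd (P1 * Q2) (P2 * Q1)" "P2 * Q1 = Q * gcd (P1 * Q2) (P2 * Q1)" "coprime P Q"
    by blast
  let ?F = "to_fract (gcd (P1 * Q2) (P2 * Q1)) / to_fract (Q1 * Q2)"
  have "A * to_fract (Q1 * Q2) = to_fract P * to_fract (gcd (P1 * Q2) (P2 * Q1))"
    using arg_cong[OF PQ(1), of to_fract] A(2) by (simp add: A(1))
  moreover have "B * to_fract (Q1 * Q2) = to_fract Q * to_fract (gcd (P1 * Q2) (P2 * Q1))"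
    using arg_cong[OF PQ(2), of to_fract] B(2) by (simp add: B(1) mult.commute)
  ultimately have "?F * to_fract P = A" "?F * to_fract Q = B"
    using A(2) B(2) by (simp_all add: divide_eq_eq mult_ac)
  then have "f = ratfun ?F \<otimes> (to_fract P, to_fract Q)"
    by (simp only: f ratfun_mult)
  with that[of ?F P Q] PQ(3) \<open>gcd _ _ \<noteq> 0\<close> A(2) B(2) show ?thesis
    by simp
qed

text \<open>
  Where the two values of \<open>y\<close> above \<open>x = 0\<close> differ, a primitive function \<open>P + Q y\<close> and its
  conjugate cannot both vanish, so its order is \<open>0\<close> or the order of its norm, a polynomial.
\<close>

lemma split_origin_unique:
  assumes "poly p 0 \<noteq> 0" and v: "v \<in> points_over K 0 0"
  shows "v x_fn = 1" and "v' \<in> points_over K 0 0 \<Longrightarrow> v = v'"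
proof -
  let ?S = "points_over K 0 0"
  have S: "?S \<subseteq> closed_points K"
    by (auto simp: points_over_def)
  have van: "vanishes_to w 1 (x_fn - const_fn 0)" "vanishes_to w 1 y_fn" if "w \<in> ?S" for w
    using that by (auto simp: points_over_def has_value_iff const_fn_0)
  have pos: "0 < w x_fn" if "w \<in> ?S" for w
    using van(1)[OF that] by (auto simp: vanishes_to_def x_fn_nonzero const_fn_0)
  have poly: "w (polyfun P) = int (order 0 P) * w x_fn" if "w \<in> ?S" "P \<noteq> 0" for w P
    using polynomial_vanishing_order[OF _ van(1) that(2)] that S by (auto simp: const_fn_0)
  have unit: "w (to_fract P, to_fract Q) = 0" if "w \<in> ?S" "poly P 0 \<noteq> 0" for w P Q
  proof -
    have w: "w \<in> closed_points K"
      using S that by auto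
    have "P \<noteq> 0" "order 0 P = 0"
      using that by (auto simp: order_root)
    then have P: "w (polyfun P) = 0"
      using poly[OF that(1)] by simp
    have "vanishes_to w (0 + 1) (polyfun Q \<otimes> y_fn)"
      using w van[OF that(1)] regular_at_x_value[OF w van(1)[OF that(1)]]
      by (intro vanishes_to_mult polynomial_regular) auto
    with point_add_dominant(2)[OF w, of "polyfun P" "polyfun Q \<otimes> y_fn"] P \<open>P \<noteq> 0\<close>
    show ?thesis
      by (simp add: y_fn_def ratfun_mult)
  qed
  have power: "\<exists>n. \<forall>w\<in>?S. w f = n * w x_fn" if f: "f \<noteq> 0" for f
  proof -
    obtain F P Q where F: "F \<noteq> 0" "f = ratfun F \<otimes> (to_fract P, to_fract Q)" "coprime P Q"
      using primitive_form[OF f] by blast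
    obtain k where k: "\<forall>w\<in>?S. w (ratfun F) = k * w x_fn"
      using ratfun_power_from_polynomials[OF S _ F(1), of "\<lambda>w. w x_fn"] poly by blast
    have nz: "(to_fract P, to_fract Q) \<noteq> (0 :: fn)"
      using F(3) by auto
    have "\<exists>n. \<forall>w\<in>?S. w (to_fract P, to_fract Q) = n * w x_fn"
    proof (cases "poly P 0 = 0")
      case False
      then have "w (to_fract P, to_fract Q) = 0 * w x_fn" if "w \<in> ?S" for w
        using unit[OF that, of P Q] by simp
      then show ?thesis
        by blast
    next
      case True
      then have "[:0, 1:] dvd P"
        by (simp add: poly_eq_0_iff_dvd)
      have "poly Q 0 \<noteq> 0"
      proof
        assume "poly Q 0 = 0"
        then have "[:0, 1:] dvd Q"
          by (simp add: poly_eq_0_iff_dvd)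
        with \<open>[:0, 1:] dvd P\<close> \<open>coprime P Q\<close> have "is_unit ([:0, 1:] :: rat poly)"
          by (blast dest: coprime_common_divisor)
        then show False
          by (simp add: is_unit_iff_degree)
      qed
      then have root: "poly (P - p * Q) 0 \<noteq> 0"
        using True assms(1) by simp
      let ?c = "(to_fract (P - p * Q), to_fract (- Q))"
      let ?N = "P\<^sup>2 - p * P * Q + q * Q\<^sup>2"
      have norm: "(to_fract P, to_fract Q) \<otimes> ?c = polyfun ?N"
        using mult_conjugate[of "to_fract P" "to_fract Q"] by (simp add: to_fract_power)
      have "?c \<noteq> 0"
        using root by auto
      then have "polyfun ?N \<noteq> 0"
        unfolding norm[symmetric] using nz by (simp add: mult_eq_0_iff)
      then have "?N \<noteq> 0"
        using polyfun_eq_0_iff by blast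
      have "w (to_fract P, to_fract Q) = int (order 0 ?N) * w x_fn" if w: "w \<in> ?S" for w
        using point_mult[OF subsetD[OF S w] nz \<open>?c \<noteq> 0\<close>] unit[OF w root, of "- Q"]
        unfolding norm poly[OF w \<open>?N \<noteq> 0\<close>] by simp
      then show ?thesis
        by blast
    qed
    then obtain n where n: "\<forall>w\<in>?S. w (to_fract P, to_fract Q) = n * w x_fn"
      by blast
    have "w f = (k + n) * w x_fn" if w: "w \<in> ?S" for w
      using point_mult[OF subsetD[OF S w], of "ratfun F", OF _ nz] F(1)
        k[rule_format, OF w] n[rule_format, OF w]
      unfolding F(2)[symmetric] by (simp add: distrib_right)
    then show ?thesis
      by blast
  qed
  have "\<forall>w\<in>?S. 0 < w x_fn" "\<forall>f. f \<noteq> 0 \<longrightarrow> (\<exists>n. \<forall>w\<in>?S. w f = n * w x_fn)"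
    using pos power by blast+
  note unique = common_uniformizer[OF S this]
  show "v x_fn = 1"
    by (rule unique(1)[OF v])
  show "v = v'" if "v' \<in> ?S"
    by (rule unique(2)[OF v that])
qed

end

section \<open>Points given by a local parametrization\<close>

context odd_hyperelliptic
begin

lemma residue_coset_eq:
  assumes v: "v \<in> closed_points K" and "vanishes_to v 1 (f - h)"
  shows "max_ideal K v +>\<^bsub>local_ring K v\<^esub> f \<subseteq> max_ideal K v +>\<^bsub>local_ring K v\<^esub> h"
proof
  fix k assume "k \<in> max_ideal K v +>\<^bsub>local_ring K v\<^esub> f"
  then obtain m where m: "m \<in> max_ideal K v" "k = m + f"
    by (auto simp: a_r_coset_def r_coset_def local_ring_def)
  have "m + (f - h) \<in> max_ideal K v"
    using m(1) assms vanishes_to_add[OF v, of 1 m "f - h"] by (simp add: max_ideal_iff)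
  moreover have "k = (m + (f - h)) + h"
    using m(2) by simp
  ultimately show "k \<in> max_ideal K v +>\<^bsub>local_ring K v\<^esub> h"
    unfolding a_r_coset_def r_coset_def local_ring_def by fastforce
qed

text \<open>
  Functions with the same value have the same residue class, so it is enough that every regular
  function has a rational value.
\<close>

lemma rational_pointI:
  assumes v: "v \<in> closed_points K"
    and residue: "\<And>f. vanishes_to v 0 f \<Longrightarrow> \<exists>c. vanishes_to v 1 (f - const_fn c)"
  shows "v \<in> rational_points K"
proof -
  let ?coset = "\<lambda>f. max_ideal K v +>\<^bsub>local_ring K v\<^esub> f"
  have carrier: "carrier (residue_field K v) = ?coset ` {f. vanishes_to v 0 f}"
  proof -
    have "{f. vanishes_to v 0 f} = carrier (local_ring K v)"
      using local_ring_iff by blast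
    then show ?thesis
      by (auto simp: residue_field_def FactRing_def A_RCOSETS_def RCOSETS_def a_r_coset_def)
  qed
  have "?coset f \<in> residue_constants K v" if f: "vanishes_to v 0 f" for f
  proof -
    obtain c where c: "vanishes_to v 1 (f - const_fn c)"
      using residue[OF f] by blast
    then have "vanishes_to v 1 (const_fn c - f)"
      using vanishes_to_minus[OF v, of 1 "f - const_fn c"] by simp
    then have "?coset f = ?coset (const_fn c)"
      using residue_coset_eq[OF v] c by blast
    then show ?thesis
      by (simp add: residue_constants_def)
  qed
  moreover have "residue_constants K v \<subseteq> ?coset ` {f. vanishes_to v 0 f}"
    using vanishes_to_const[OF v] by (auto simp: residue_constants_def)
  ultimately have "carrier (residue_field K v) = residue_constants K v"
    unfolding carrier by blast
  with v show ?thesis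
    by (simp add: rational_points_def)
qed

subsection \<open>Laurent expansions of functions\<close>

text \<open>
  The expansion with \<open>x = \<xi>\<close> and \<open>z = \<zeta>\<close>, that is, with \<open>y = (\<zeta> - p(\<xi>)) / 2\<close>.
\<close>

definition expansion :: "rat fls \<Rightarrow> rat fls \<Rightarrow> fn \<Rightarrow> rat fls" where
  "expansion \<xi> \<zeta> f = fract_at \<xi> (fst f) + fract_at \<xi> (snd f) * ((\<zeta> - poly_at \<xi> p) / 2)"

definition expansion_order :: "rat fls \<Rightarrow> rat fls \<Rightarrow> point" where
  "expansion_order \<xi> \<zeta> f = fls_subdegree (expansion \<xi> \<zeta> f)"

context
  fixes \<xi> \<zeta> :: "rat fls"
  assumes deriv: "fls_deriv \<xi> \<noteq> 0"
    and root: "\<zeta>\<^sup>2 = poly_at \<xi> D"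
begin

interpretation nonconstant_series \<xi>
  by unfold_locales (rule deriv)

abbreviation e where "e \<equiv> expansion \<xi> \<zeta>"

lemma expansion_ratfun: "e (ratfun F) = fract_at \<xi> F"
  by (simp add: expansion_def)

lemma expansion_polyfun: "e (polyfun P) = poly_at \<xi> P"
  by (simp add: expansion_ratfun)

lemma expansion_const: "e (const_fn c) = fls_const c"
  by (simp add: const_fn_def expansion_polyfun)

lemma expansion_x: "e x_fn = \<xi>"
  by (simp add: x_fn_def expansion_polyfun)

lemma expansion_y: "e y_fn = (\<zeta> - poly_at \<xi> p) / 2"
  by (simp add: y_fn_def expansion_def)

lemma expansion_add: "e (f + h) = e f + e h"
  by (simp only: expansion_def fst_add snd_add fract_at_add distrib_right ac_simps)

lemma expansion_0: "e 0 = 0"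
  by (simp add: expansion_def)

lemma expansion_diff: "e (f - h) = e f - e h"
  by (simp only: expansion_def fst_diff snd_diff fract_at_diff left_diff_distrib add_diff_add)

lemma expansion_mult: "e (f \<otimes> h) = e f * e h"
proof -
  have two: "(2 :: rat fls) \<noteq> 0" and "(4 :: rat fls) \<noteq> 0"
    by (metis fls_const_numeral fls_const_eq_0_iff zero_neq_numeral)+
  define \<eta> where "\<eta> = (\<zeta> - poly_at \<xi> p) / 2"
  have "4 * \<eta>\<^sup>2 = (\<zeta> - poly_at \<xi> p)\<^sup>2"
    by (simp add: \<eta>_def power_divide)
  also have "\<dots> = poly_at \<xi> D - 2 * \<zeta> * poly_at \<xi> p + (poly_at \<xi> p)\<^sup>2"
    by (simp add: power2_diff root)
  also have "poly_at \<xi> D = (poly_at \<xi> p)\<^sup>2 - 4 * poly_at \<xi> q"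
  proof -
    have "(4 :: rat poly) = [:4:]"
      by (simp add: numeral_poly)
    then have "poly_at \<xi> (4 :: rat poly) = 4"
      by (simp only: poly_at_const fls_const_numeral)
    then show ?thesis
      by (simp add: D_def poly_at_diff poly_at_mult poly_at_power)
  qed
  also have "\<zeta> = 2 * \<eta> + poly_at \<xi> p"
    using two by (simp add: \<eta>_def field_simps)
  finally have "4 * (\<eta> * \<eta>) = 4 * (- poly_at \<xi> q - poly_at \<xi> p * \<eta>)"
    by (simp add: power2_eq_square algebra_simps)
  then have \<eta>2: "\<eta> * \<eta> = - poly_at \<xi> q - poly_at \<xi> p * \<eta>"
    by (simp only: mult_left_cancel[OF \<open>(4 :: rat fls) \<noteq> 0\<close>])
  obtain A B A' B' where f: "f = (A, B)" and h: "h = (A', B')"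
    by force
  let ?i = "fract_at \<xi>"
  have "e f * e h = ?i A * ?i A' + (?i A * ?i B' + ?i B * ?i A') * \<eta> + ?i B * ?i B' * (\<eta> * \<eta>)"
    by (simp add: f h expansion_def algebra_simps flip: \<eta>_def)
  also have "\<dots> = e (f \<otimes> h)"
    unfolding \<eta>2
    by (simp add: f h expansion_def mult_Pair fract_at_diff fract_at_add fract_at_mult
        algebra_simps flip: \<eta>_def)
  finally show ?thesis ..
qed

lemma expansion_z: "e z_fn = \<zeta>"
proof -
  have "z_fn = polyfun p + (y_fn + y_fn)"
    by (simp add: root_fn_def y_fn_def)
  then show ?thesis
    by (simp only: expansion_add expansion_y expansion_polyfun) simp
qed

text \<open>
  A ring homomorphism out of a field is injective.
\<close>

lemma expansion_nonzero: "f \<noteq> 0 \<Longrightarrow> e f \<noteq> 0"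
proof
  assume "f \<noteq> 0" "e f = 0"
  then have "f \<otimes> inv f = \<one>"
    using field_Units by (intro Units_r_inv) simp
  then have "e f * e (inv f) = e \<one>"
    by (simp only: expansion_mult[symmetric])
  with \<open>e f = 0\<close> show False
    by (simp add: one_K expansion_ratfun)
qed

lemma expansion_power: "e (f [^] (n :: nat)) = e f ^ n"
  by (induction n) (simp_all add: one_K expansion_ratfun expansion_mult)

text \<open>
  The leading exponents of the expansions define a valuation. It is normalised as soon as some
  function expands with leading exponent one, and the constant coefficients give its residues.
\<close>

lemma expansion_order_rational_point:
  assumes "expansion_order \<xi> \<zeta> t = 1"
  shows "expansion_order \<xi> \<zeta> \<in> rational_points K"
proof (rule rational_pointI)
  let ?v = "expansion_order \<xi> \<zeta>"
  have "t \<noteq> 0"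
    using assms by (auto simp: expansion_order_def expansion_0)
  have "?v (f \<otimes> h) = ?v f + ?v h" if "f \<noteq> 0" "h \<noteq> 0" for f h
    using expansion_nonzero[OF that(1)] expansion_nonzero[OF that(2)]
    by (simp add: expansion_order_def expansion_mult)
  moreover have "min (?v f) (?v h) \<le> ?v (f + h)" if "f + h \<noteq> 0" for f h
    using fls_plus_subdegree[of "e f" "e h"] expansion_nonzero[OF that]
    by (simp add: expansion_order_def expansion_add)
  moreover have "?v (const_fn c) = 0" for c
    by (simp add: expansion_order_def expansion_const)
  moreover have "?v 0 = 0"
    by (simp add: expansion_order_def expansion_0)
  ultimately show closed: "?v \<in> closed_points K"
    using assms \<open>t \<noteq> 0\<close> by (auto simp: closed_points_def)
  fix f assume f: "vanishes_to ?v 0 f"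
  let ?c = "fls_nth (e f) 0"
  have "1 \<le> ?v (f - const_fn ?c)" if "f - const_fn ?c \<noteq> 0"
    unfolding expansion_order_def
  proof (rule fls_subdegree_geI)
    show "e (f - const_fn ?c) \<noteq> 0"
      by (rule expansion_nonzero[OF that])
    fix k :: int assume "k < 1"
    have "fls_nth (e f) k = 0" if "k < 0"
      using f that by (auto simp: vanishes_to_def expansion_order_def expansion_0)
    with \<open>k < 1\<close> show "fls_nth (e (f - const_fn ?c)) k = 0"
      by (cases "k = 0") (simp_all add: expansion_diff expansion_const)
  qed
  then show "\<exists>c. vanishes_to ?v 1 (f - const_fn c)"
    unfolding vanishes_to_def by blast
qed

lemma expansion_vanishes_to:
  assumes "e f = fps_to_fls \<sigma>" "fps_nth \<sigma> 0 = 0"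
  shows "vanishes_to (expansion_order \<xi> \<zeta>) 1 f"
proof (cases "f = 0")
  case False
  then have "e f \<noteq> 0"
    by (rule expansion_nonzero)
  then have "1 \<le> fls_subdegree (e f)"
    using assms by (intro fls_subdegree_geI) (auto simp: nat_eq_iff)
  then show ?thesis
    by (simp add: vanishes_to_def expansion_order_def)
qed (simp add: vanishes_to_def)

end

subsection \<open>The point with \<open>x = y = 0\<close>\<close>

lemma split_origin_exists:
  assumes "poly p 0 \<noteq> 0" "poly q 0 = 0"
  shows "\<exists>v \<in> rational_points K. v \<in> points_over K 0 0"
proof -
  \<comment> \<open>Of the two square roots of \<open>D\<close>, the one with constant term \<open>p(0)\<close> is the one for which
    \<open>y = (z - p) / 2\<close> vanishes.\<close>
  define \<rho> where "\<rho> = fps_radical (\<lambda>_ _. poly p 0) (Suc 1) (fps_of_poly D)"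
  have D0: "fps_nth (fps_of_poly D) 0 = (poly p 0)\<^sup>2"
    using assms(2) by (simp add: D_def fps_of_poly_nth flip: poly_0_coeff_0)
  then have "fps_nth (fps_of_poly D) 0 \<noteq> 0"
    using assms(1) by simp
  from power_radical[OF this, of "\<lambda>_ _. poly p 0" 1] have "\<rho> ^ Suc 1 = fps_of_poly D"
    using D0 by (simp add: \<rho>_def power2_eq_square)
  then have square: "\<rho>\<^sup>2 = fps_of_poly D"
    by (simp add: numeral_2_eq_2)
  have at_X: "poly_at fls_X P = fps_to_fls (fps_of_poly P)" for P
    using poly_at_translate[of fps_X 0 P] by (simp add: pcompose_idR[simplified])
  have deriv: "fls_deriv (fls_X :: rat fls) \<noteq> 0"
    by simp
  have root: "(fps_to_fls \<rho>)\<^sup>2 = poly_at fls_X D"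
    unfolding at_X square[symmetric] by (simp add: fps_to_fls_power)
  let ?v = "expansion_order fls_X (fps_to_fls \<rho>)"
  have "?v x_fn = 1"
    by (simp add: expansion_order_def expansion_x[OF deriv root])
  then have rational: "?v \<in> rational_points K"
    by (rule expansion_order_rational_point[OF deriv root])
  have x: "vanishes_to ?v 1 (x_fn - const_fn 0)"
    using \<open>?v x_fn = 1\<close> by (simp add: vanishes_to_def const_fn_0)
  have "expansion fls_X (fps_to_fls \<rho>) y_fn =
          fps_to_fls (fps_const (1 / 2) * (\<rho> - fps_of_poly p))"
    by (simp add: expansion_y[OF deriv root] at_X fls_times_fps_to_fls flip: fls_const_divide_const)
  moreover have "fps_nth \<rho> 0 = poly p 0"
    by (simp add: \<rho>_def)
  then have "fps_nth (fps_const (1 / 2) * (\<rho> - fps_of_poly p)) 0 = 0"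
    by (simp add: fps_of_poly_nth flip: poly_0_coeff_0)
  ultimately have "vanishes_to ?v 1 y_fn"
    by (rule expansion_vanishes_to[OF deriv root])
  then have y: "vanishes_to ?v 1 (y_fn - const_fn 0)"
    by (simp add: const_fn_0)
  show ?thesis
    using rational x y by (auto simp: points_over_def has_value_iff rational_points_def)
qed

subsection \<open>Branch points\<close>

text \<open>
  If \<open>G\<close> has a simple zero at \<open>0\<close>, then \<open>G(s) = t\<^sup>2\<close> can be solved for \<open>s\<close> as a power
  series in \<open>t\<close>. At a branch point, \<open>t\<close> is a local parameter and \<open>s\<close> the coordinate on the line.
\<close>

lemma solve_square:
  fixes G :: "rat fps"
  assumes "fps_nth G 0 = 0" "fps_nth G 1 \<noteq> 0"
  obtains \<sigma> where "fps_nth \<sigma> 0 = 0" "G oo \<sigma> = fps_X\<^sup>2"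
proof
  let ?\<sigma> = "fps_inv G oo fps_X\<^sup>2"
  have [simp]: "fps_nth (fps_X\<^sup>2 :: rat fps) 0 = 0" "fps_nth (fps_inv G) 0 = 0"
    by (simp_all add: fps_inv_def)
  show "fps_nth ?\<sigma> 0 = 0"
    by simp
  have "G oo ?\<sigma> = G oo fps_inv G oo fps_X\<^sup>2"
    by (rule fps_compose_assoc) simp_all
  also have "\<dots> = fps_X\<^sup>2"
    using assms by (simp add: fps_inv_right)
  finally show "G oo ?\<sigma> = fps_X\<^sup>2" .
qed

lemma finite_branch_point_exists:
  assumes "poly D a = 0" "poly (pderiv D) a \<noteq> 0"
  shows "\<exists>v \<in> rational_points K. vanishes_to v 1 (x_fn - const_fn a)"
proof -
  let ?G = "fps_of_poly (pcompose D [:a, 1:])"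
  have "coeff (pcompose D [:a, 1:]) 0 = 0"
    using assms(1) by (simp add: poly_pcompose flip: poly_0_coeff_0)
  moreover have "coeff (pcompose D [:a, 1:]) 1 = poly (pderiv (pcompose D [:a, 1:])) 0"
    by (simp add: poly_0_coeff_0 coeff_pderiv)
  then have "coeff (pcompose D [:a, 1:]) 1 \<noteq> 0"
    using assms(2) by (simp add: pderiv_pcompose poly_pcompose pderiv_pCons)
  ultimately obtain \<sigma> where \<sigma>: "fps_nth \<sigma> 0 = 0" "?G oo \<sigma> = fps_X\<^sup>2"
    using solve_square[of ?G] by (auto simp: fps_of_poly_nth)
  define \<xi> where "\<xi> = fps_to_fls (fps_const a + \<sigma>)"
  have root: "fls_X\<^sup>2 = poly_at \<xi> D"
    unfolding \<xi>_def poly_at_translate[OF \<sigma>(1)] \<sigma>(2)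
    by (simp add: fps_to_fls_power)
  \<comment> \<open>If \<open>\<xi>\<close> were constant, so would be \<open>D(\<xi>) = t\<^sup>2\<close>.\<close>
  have deriv: "fls_deriv \<xi> \<noteq> 0"
  proof
    assume "fls_deriv \<xi> = 0"
    then have "fls_deriv (fls_X\<^sup>2 :: rat fls) = 0"
      unfolding root fls_deriv_poly_at by simp
    then show False
      by (simp add: power2_eq_square)
  qed
  let ?v = "expansion_order \<xi> fls_X"
  have "?v z_fn = 1"
    by (simp add: expansion_order_def expansion_z[OF deriv root])
  then have "?v \<in> rational_points K"
    by (rule expansion_order_rational_point[OF deriv root])
  moreover have "expansion \<xi> fls_X (x_fn - const_fn a) = fps_to_fls \<sigma>"
    unfolding expansion_diff[OF deriv root] expansion_x[OF deriv root]
      expansion_const[OF deriv root]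
    by (simp add: \<xi>_def)
  then have "vanishes_to ?v 1 (x_fn - const_fn a)"
    using \<sigma>(1) by (rule expansion_vanishes_to[OF deriv root])
  ultimately show ?thesis
    by blast
qed

lemma poly_at_reflect:
  assumes "s \<noteq> 0"
  shows "poly_at s (reflect_poly P) = s ^ degree P * poly_at (inverse s) P"
proof -
  have deg: "degree (map_poly fls_const P) = degree P"
    by (intro degree_map_poly) simp
  have "map_poly fls_const (reflect_poly P) = reflect_poly (map_poly fls_const P)"
    by (intro poly_eqI) (simp add: coeff_map_poly coeff_reflect_poly deg)
  then show ?thesis
    using poly_reflect_poly_nz[OF assms, of "map_poly fls_const P"] by (simp add: poly_at_def deg)
qed

text \<open>
  In terms of \<open>s = 1 / x\<close>, the polynomial \<open>D(x)\<close> of degree \<open>2 k + 1\<close> is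
  \<open>s D\<^sup>*(s) / s ^ (2 k + 2)\<close> with \<open>D\<^sup>*\<close> the reflected polynomial, and \<open>s D\<^sup>*(s)\<close> has a simple
  zero at \<open>0\<close>. Solving \<open>s D\<^sup>*(s) = t\<^sup>2\<close> for \<open>s\<close> makes \<open>D(x)\<close> the square of
  \<open>t / s ^ (k + 1)\<close>.
\<close>

lemma infinity_exists: "\<exists>v \<in> rational_points K. v \<in> points_at_infinity K"
proof -
  obtain k where k: "degree D = 2 * k + 1"
    using odd_degree by (rule oddE)
  let ?G = "fps_of_poly (pCons 0 (reflect_poly D))"
  obtain \<sigma> where \<sigma>: "fps_nth \<sigma> 0 = 0" "?G oo \<sigma> = fps_X\<^sup>2"
    using solve_square[of ?G] D_nonzero by (auto simp: fps_of_poly_nth)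
  define s where "s = fps_to_fls \<sigma>"
  have "poly_at s (pCons 0 (reflect_poly D)) = fls_X\<^sup>2"
    using poly_at_translate[OF \<sigma>(1), of 0 "pCons 0 (reflect_poly D)"] \<sigma>(2)
    by (simp add: s_def fps_to_fls_power pcompose_idR[simplified])
  then have sG: "s * poly_at s (reflect_poly D) = fls_X\<^sup>2"
    by (simp add: poly_at_pCons)
  then have s: "s \<noteq> 0"
    by auto
  have sub: "0 < fls_subdegree s"
  proof -
    have "1 \<le> fls_subdegree s"
      using s \<sigma>(1) by (intro fls_subdegree_geI) (auto simp: s_def nat_eq_iff)
    then show ?thesis
      by simp
  qed
  define \<xi> \<zeta> where "\<xi> = inverse s" and "\<zeta> = fls_X / s ^ Suc k"
  have "\<zeta>\<^sup>2 = s * (s ^ degree D * poly_at \<xi> D) / (s ^ Suc k)\<^sup>2"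
    unfolding \<xi>_def poly_at_reflect[OF s, symmetric] sG by (simp add: \<zeta>_def power_divide)
  also have "\<dots> = poly_at \<xi> D"
    using s by (simp add: k power2_eq_square power_add power_mult_distrib mult_2 mult_2_right field_simps)
  finally have root: "\<zeta>\<^sup>2 = poly_at \<xi> D" .
  have neg: "fls_subdegree \<xi> < 0"
    using sub by (simp add: \<xi>_def)
  have deriv: "fls_deriv \<xi> \<noteq> 0"
  proof
    assume "fls_deriv \<xi> = 0"
    then have "\<xi> = fls_const (fls_nth \<xi> 0)"
      by (simp add: fls_deriv_eq_0_iff)
    then have "fls_subdegree \<xi> = 0"
      by (metis fls_const_subdegree)
    with neg show False
      by simp
  qed
  let ?v = "expansion_order \<xi> \<zeta>" and ?t = infinity_uniformizer
  have "x_fn [^] Suc k \<in> Units K"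
    using pow_nonzero[OF x_fn_nonzero, of "Suc k"] field_Units by simp
  then have "x_fn [^] Suc k \<otimes> (inv (x_fn [^] Suc k) \<otimes> z_fn) = z_fn"
    by (simp only: m_assoc[symmetric] Units_closed Units_inv_closed Units_r_inv carrier_K UNIV_I l_one)
  then have "x_fn [^] Suc k \<otimes> ?t = z_fn"
    by (simp only: infinity_uniformizer_def k) simp
  then have "\<xi> ^ Suc k * expansion \<xi> \<zeta> ?t = \<zeta>"
    by (metis expansion_mult[OF deriv root] expansion_power[OF deriv root]
        expansion_x[OF deriv root] expansion_z[OF deriv root])
  then have "expansion \<xi> \<zeta> ?t = fls_X"
    using s by (simp add: \<xi>_def \<zeta>_def field_simps)
  then have "?v ?t = 1"
    by (simp add: expansion_order_def)
  then have "?v \<in> rational_points K"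
    by (rule expansion_order_rational_point[OF deriv root])
  moreover have "?v x_fn < 0"
    using neg by (simp add: expansion_order_def expansion_x[OF deriv root])
  ultimately show ?thesis
    by (auto simp: points_at_infinity_eq rational_points_def)
qed

end

section \<open>Torsion in the Picard group\<close>

context odd_hyperelliptic
begin

text \<open>
  The degree of a point is a dimension over the field of residues of constants. For a rational
  point this field is the whole residue field, which has dimension one over itself.
\<close>

lemma residue_field_is_field:
  assumes v: "v \<in> closed_points K"
  shows "field (residue_field K v)"
proof -
  let ?L = "local_ring K v"
  have carrier_L: "carrier ?L = {f. vanishes_to v 0 f}"
    using local_ring_iff by blast
  have L: "?L = K\<lparr>carrier := {f. vanishes_to v 0 f}\<rparr>"
    unfolding local_ring_def by (simp add: vanishes_to_def)
  have uminus: "\<ominus> f = - f" for f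
    by (rule minus_equality) simp_all
  have weaken: "vanishes_to v 0 f" if "vanishes_to v 1 f" for f
    using vanishes_to_mono[OF that] by simp
  have one: "vanishes_to v 0 \<one>"
    by (simp add: vanishes_to_def point_one[OF v])
  have "subring {f. vanishes_to v 0 f} K"
    using vanishes_to_minus[OF v, of 0] vanishes_to_add[OF v, of 0]
      vanishes_to_mult[OF v, of 0 _ 0] one
    by (intro subringI) (auto simp: uminus)
  then interpret L: domain ?L
    unfolding L by (rule subring_is_domain)
  have ideal: "ideal (max_ideal K v) ?L"
  proof (rule idealI)
    show "ring ?L"
      by (rule L.ring_axioms)
    show "subgroup (max_ideal K v) (add_monoid ?L)"
    proof (rule group.subgroupI[OF L.add.is_group])
      show "max_ideal K v \<subseteq> carrier (add_monoid ?L)"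
        by (auto simp: max_ideal_iff carrier_L intro: weaken)
      show "max_ideal K v \<noteq> {}"
        by (auto simp: max_ideal_iff vanishes_to_def)
      fix f h assume f: "f \<in> max_ideal K v" and h: "h \<in> max_ideal K v"
      show "f \<otimes>\<^bsub>add_monoid ?L\<^esub> h \<in> max_ideal K v"
        using f h vanishes_to_add[OF v, of 1 f h] by (simp add: max_ideal_iff local_ring_def)
      have "- f \<in> carrier ?L" "f \<in> carrier ?L"
        using f vanishes_to_minus[OF v, of 1 f]
        by (auto simp: max_ideal_iff carrier_L intro: weaken)
      then have "inv\<^bsub>add_monoid ?L\<^esub> f = - f"
        unfolding a_inv_def[symmetric] by (intro L.minus_equality) (simp_all add: local_ring_def)
      then show "inv\<^bsub>add_monoid ?L\<^esub> f \<in> max_ideal K v"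
        using f vanishes_to_minus[OF v, of 1 f] by (simp add: max_ideal_iff)
    qed
    fix f h assume "f \<in> max_ideal K v" "h \<in> carrier ?L"
    then show "h \<otimes>\<^bsub>?L\<^esub> f \<in> max_ideal K v" "f \<otimes>\<^bsub>?L\<^esub> h \<in> max_ideal K v"
      using vanishes_to_mult[OF v, of 0 h 1 f] vanishes_to_mult[OF v, of 1 f 0 h]
      by (simp_all add: max_ideal_iff carrier_L, simp_all add: local_ring_def)
  qed
  have "maximalideal (max_ideal K v) ?L"
  proof (rule maximalidealI[OF ideal])
    have "\<one> \<notin> max_ideal K v"
      by (simp add: max_ideal_iff vanishes_to_def point_one[OF v], simp add: one_K)
    then show "carrier ?L \<noteq> max_ideal K v"
      using one carrier_L by blast
    fix J assume J: "ideal J ?L" "max_ideal K v \<subseteq> J" "J \<subseteq> carrier ?L"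
    show "J = max_ideal K v \<or> J = carrier ?L"
    proof (cases "J \<subseteq> max_ideal K v")
      case True
      with J(2) show ?thesis
        by blast
    next
      case False
      then obtain f where f: "f \<in> J" "f \<notin> max_ideal K v"
        by blast
      then have "f \<noteq> 0" "v f = 0"
        using J(3) carrier_L by (auto simp: max_ideal_iff vanishes_to_def)
      then have "inv f \<in> carrier ?L" "inv f \<otimes> f = \<one>"
        using point_inv[OF v] field_Units by (auto simp: carrier_L vanishes_to_def)
      then have "\<one>\<^bsub>?L\<^esub> \<in> J"
        using ideal.I_l_closed[OF J(1) f(1), of "inv f"] by (simp add: local_ring_def)
      then show ?thesis
        using ideal.one_imp_carrier[OF J(1)] by blast
    qed
  qed
  then show ?thesis
    unfolding residue_field_def by (rule maximalideal.quotient_is_field[OF _ L.is_cring])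
qed

lemma rational_point_degree:
  assumes "v \<in> rational_points K"
  shows "point_degree K v = 1"
proof -
  have v: "v \<in> closed_points K" and eq: "residue_constants K v = carrier (residue_field K v)"
    using assms by (auto simp: rational_points_def)
  interpret F: field "residue_field K v"
    by (rule residue_field_is_field[OF v])
  have sub: "subfield (carrier (residue_field K v)) (residue_field K v)"
    by (rule F.carrier_is_subfield)
  show ?thesis
    unfolding point_degree_def eq F.dim_def
    using F.dimension_one[OF sub] F.dimension_is_inj[OF sub _ F.dimension_one[OF sub]]
    by (intro the_equality) blast+
qed

lemma degree_difference:
  assumes "R \<in> rational_points K" "S \<in> rational_points K"
  shows "divisor_degree K (frag_of R - frag_of S) = 0"
proof -
  let ?D = "frag_of R - frag_of S"
  have "Poly_Mapping.keys ?D \<subseteq> {R, S}"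
    by (metis keys_diff keys_frag_of Un_insert_left sup_bot_left)
  then have "divisor_degree K ?D =
      (\<Sum>P \<in> {R, S}. Poly_Mapping.lookup ?D P * int (point_degree K P))"
    unfolding divisor_degree_def
    by (intro sum.mono_neutral_left) (auto simp: in_keys_iff)
  also have "\<dots> = 0"
    using assms by (cases "R = S") (simp_all add: rational_point_degree lookup_minus)
  finally show ?thesis .
qed

lemma Div_simps:
  "carrier (Div K) = {E. Poly_Mapping.keys E \<subseteq> closed_points K}"
  "E \<otimes>\<^bsub>Div K\<^esub> E' = E + E'" "\<one>\<^bsub>Div K\<^esub> = 0"
  by (simp_all add: Div_def free_Abelian_group_def)

lemma principal_divisorsI:
  assumes "E \<in> carrier (Div K)" "h \<noteq> 0" "is_div_of K E h"
  shows "E \<in> principal_divisors K"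
proof -
  have "h \<in> carrier K - {\<zero>}"
    using assms(2) by simp
  with assms(1,3) show ?thesis
    unfolding principal_divisors_def by blast
qed

lemma principal_divisors_subgroup: "subgroup (principal_divisors K) (Div K)"
proof -
  interpret G: comm_group "Div K"
    unfolding Div_def by (rule abelian_free_Abelian_group)
  show ?thesis
  proof (rule G.subgroupI)
    show "principal_divisors K \<subseteq> carrier (Div K)"
      by (auto simp: principal_divisors_def)
    have "is_div_of K 0 \<one>"
      by (simp add: is_div_of_def point_one)
    moreover have "\<one> \<noteq> 0"
      by (simp add: one_K)
    ultimately have "0 \<in> principal_divisors K"
      by (auto simp: principal_divisors_def Div_simps)
    then show "principal_divisors K \<noteq> {}"
      by blast
    fix E E' assume "E \<in> principal_divisors K" "E' \<in> principal_divisors K"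
    then obtain h h' where h: "h \<noteq> 0" "is_div_of K E h" "h' \<noteq> 0" "is_div_of K E' h'"
      and E: "E \<in> carrier (Div K)" "E' \<in> carrier (Div K)"
      by (auto simp: principal_divisors_def)
    have "is_div_of K (E + E') (h \<otimes> h')"
      using h by (simp add: is_div_of_def point_mult lookup_add)
    moreover have "E + E' \<in> carrier (Div K)"
      using G.m_closed[OF E] by (simp add: Div_simps)
    moreover have "h \<otimes> h' \<noteq> 0"
      using h by (simp add: mult_eq_0_iff)
    ultimately show "E \<otimes>\<^bsub>Div K\<^esub> E' \<in> principal_divisors K"
      unfolding Div_simps(2) by (auto simp: principal_divisors_def)
    have "inv\<^bsub>Div K\<^esub> E = - E"
      using E(1) by (simp add: Div_def)
    moreover have "- E \<in> carrier (Div K)"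
      using E(1) by (simp add: Div_simps)
    moreover have "is_div_of K (- E) (inv h)"
      using h by (simp add: is_div_of_def point_inv)
    ultimately show "inv\<^bsub>Div K\<^esub> E \<in> principal_divisors K"
      using inv_nonzero[OF h(1)] by (auto simp: principal_divisors_def)
  qed
qed

text \<open>
  A function whose divisor is \<open>N E\<close> makes the \<open>N\<close>-th power of the class of \<open>E\<close> trivial.
\<close>

lemma torsion_class:
  assumes E: "E \<in> carrier (Div K)" "divisor_degree K E = 0" and "N \<ge> 1" "h \<noteq> 0"
    and div: "\<And>v. v \<in> closed_points K \<Longrightarrow> v h = int N * Poly_Mapping.lookup E v"
  shows "is_torsion (Pic0 K) (divisor_class K E)"
proof -
  interpret G: comm_group "Div K"
    unfolding Div_def by (rule abelian_free_Abelian_group)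
  interpret H: normal "principal_divisors K" "Div K"
    using principal_divisors_subgroup by (simp add: G.normal_iff_subgroup)
  let ?ND = "E [^]\<^bsub>Div K\<^esub> N"
  have ND: "?ND = frag_cmul (int N) E"
    by (simp add: Div_def)
  have "is_div_of K ?ND h"
    unfolding ND by (simp add: is_div_of_def div)
  moreover have ND_closed: "?ND \<in> carrier (Div K)"
    by (rule G.nat_pow_closed[OF E(1)])
  ultimately have "?ND \<in> principal_divisors K"
    using \<open>h \<noteq> 0\<close> by (intro principal_divisorsI)
  then have "principal_divisors K #>\<^bsub>Div K\<^esub> ?ND = principal_divisors K"
    by (intro G.coset_join2 ND_closed principal_divisors_subgroup)
  then have "divisor_class K E [^]\<^bsub>Pic K\<^esub> N = \<one>\<^bsub>Pic K\<^esub>"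
    unfolding divisor_class_def Pic_def H.FactGroup_pow[OF E(1)] by simp
  moreover have "divisor_class K E [^]\<^bsub>Pic0 K\<^esub> N = divisor_class K E [^]\<^bsub>Pic K\<^esub> N"
    by (simp add: Pic0_def nat_pow_def)
  moreover have "divisor_class K E \<in> carrier (Pic0 K)"
    using E by (simp add: Pic0_def)
  ultimately show ?thesis
    using \<open>N \<ge> 1\<close> by (auto simp: is_torsion_def Pic0_def)
qed

text \<open>
  Functions with divisors \<open>N ((R) - (Q))\<close> and \<open>N ((S) - (Q))\<close> have a quotient with divisor
  \<open>N ((R) - (S))\<close>, so it suffices to compare all three points with one base point \<open>Q\<close>.
\<close>

lemma defines_K2T_elementI:
  assumes rational: "{R1, R2, R3} \<subseteq> rational_points K" and distinct: "distinct [R1, R2, R3]"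
    and "N \<ge> 1"
    and div: "\<And>R. R \<in> {R1, R2, R3} \<Longrightarrow> \<exists>h. h \<noteq> 0 \<and>
      (\<forall>v \<in> closed_points K. v h = int N * (of_bool (v = R) - of_bool (v = Q)))"
  shows "defines_K2T_element K R1 R2 R3"
proof -
  have "is_torsion (Pic0 K) (divisor_class K (frag_of R - frag_of S))"
    if R: "R \<in> {R1, R2, R3}" and S: "S \<in> {R1, R2, R3}" for R S
  proof -
    obtain h k where
      h: "h \<noteq> 0" "\<forall>v \<in> closed_points K. v h = int N * (of_bool (v = R) - of_bool (v = Q))" and
      k: "k \<noteq> 0" "\<forall>v \<in> closed_points K. v k = int N * (of_bool (v = S) - of_bool (v = Q))"
      using div[OF R] div[OF S] by blast
    have RS: "R \<in> rational_points K" "S \<in> rational_points K"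
      using rational R S by blast+
    show ?thesis
    proof (rule torsion_class[OF _ degree_difference[OF RS] \<open>N \<ge> 1\<close>])
      have "R \<in> closed_points K" "S \<in> closed_points K"
        using RS by (simp_all add: rational_points_def)
      then show "frag_of R - frag_of S \<in> carrier (Div K)"
        using keys_diff[of "frag_of R" "frag_of S"] by (auto simp: Div_simps)
      show "h \<otimes> inv k \<noteq> 0"
        using h(1) inv_nonzero[OF k(1)] by (simp add: mult_eq_0_iff)
      fix v assume v: "v \<in> closed_points K"
      have "v (h \<otimes> inv k) = v h - v k"
        using point_mult[OF v h(1) inv_nonzero[OF k(1)]] point_inv[OF v k(1)] by simp
      also have "\<dots> = int N * (of_bool (v = R) - of_bool (v = S))"
        using h(2)[rule_format, OF v] k(2)[rule_format, OF v] by (simp add: right_diff_distrib)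
      also have "of_bool (v = R) - of_bool (v = S)
                   = Poly_Mapping.lookup (frag_of R - frag_of S) v"
        by (auto simp: lookup_minus)
      finally show "v (h \<otimes> inv k) = int N * Poly_Mapping.lookup (frag_of R - frag_of S) v" .
    qed
  qed
  with rational distinct show ?thesis
    by (simp add: defines_K2T_element_def)
qed

end

section \<open>The divisors of \<open>y\<close> and of \<open>x - a\<close>\<close>

context odd_hyperelliptic
begin

lemma vanishes_at_root:
  assumes v: "v \<in> closed_points K" "vanishes_to v 1 (x_fn - const_fn a)" and "poly P a = 0"
  shows "vanishes_to v 1 (polyfun P)"
proof -
  obtain R where "P = [:- a, 1:] * R"
    using assms(3) by (auto simp only: poly_eq_0_iff_dvd elim: dvdE)
  then have "to_fract P = to_fract [:- a, 1:] * to_fract R"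
    by (simp only: to_fract_mult)
  then have "polyfun P = (x_fn - const_fn a) \<otimes> polyfun R"
    by (simp only: x_minus_const ratfun_mult_ratfun)
  then show ?thesis
    using vanishes_to_mult[OF v polynomial_regular[OF v(1) regular_at_x_value[OF v]], of R] by simp
qed

text \<open>
  At a point above \<open>x = a\<close> with \<open>a\<close> a root of \<open>D\<close>, the quadratic polynomial for \<open>y\<close> becomes
  a square modulo \<open>x - a\<close>, so the value of \<open>y\<close> is forced.
\<close>

lemma y_value_at_branch_point:
  assumes v: "v \<in> closed_points K" "vanishes_to v 1 (x_fn - const_fn a)"
    and c: "poly p a = - 2 * c" "poly q a = c\<^sup>2"
  shows "vanishes_to v 1 (y_fn - const_fn c)"
proof (cases "y_fn - const_fn c = 0")
  case False
  have "(y_fn - const_fn c) \<otimes> (y_fn - const_fn c)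
          = polyfun ([:c:]\<^sup>2 - q) - polyfun (p + [:2 * c:]) \<otimes> y_fn"
  proof -
    have "[:2 * c:] = [:c:] + [:c:]"
      by simp
    then have "to_fract [:2 * c:] = to_fract [:c:] + to_fract [:c:]"
      by (simp only: to_fract_add)
    moreover have "to_fract [:c:] * to_fract [:c:] = to_fract [:c * c:]"
      by (simp flip: to_fract_mult)
    ultimately show ?thesis
      by (simp add: y_fn_def const_fn_def mult_Pair power2_eq_square algebra_simps)
  qed
  moreover have "vanishes_to v 1 (polyfun ([:c:]\<^sup>2 - q))"
    by (rule vanishes_at_root[OF v]) (simp add: c)
  moreover have "vanishes_to v (1 + 0) (polyfun (p + [:2 * c:]) \<otimes> y_fn)"
    by (rule vanishes_to_mult[OF v(1) vanishes_at_root[OF v] y_regular[OF v(1) regular_at_x_value[OF v]]])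
      (simp add: c)
  then have "vanishes_to v 1 (polyfun (p + [:2 * c:]) \<otimes> y_fn)"
    by simp
  ultimately have "vanishes_to v 1 ((y_fn - const_fn c) \<otimes> (y_fn - const_fn c))"
    using vanishes_to_diff[OF v(1)] by metis
  moreover have "v ((y_fn - const_fn c) \<otimes> (y_fn - const_fn c)) = 2 * v (y_fn - const_fn c)"
    using point_mult[OF v(1) False False] by simp
  moreover have "(y_fn - const_fn c) \<otimes> (y_fn - const_fn c) \<noteq> 0"
    using False mult_eq_0_iff by blast
  ultimately show ?thesis
    unfolding vanishes_to_def by linarith
qed (simp add: vanishes_to_def)

lemma branch_point:
  assumes "poly D a = 0" "poly (pderiv D) a \<noteq> 0" and c: "poly p a = - 2 * c" "poly q a = c\<^sup>2"
  obtains P where "P \<in> rational_points K" "points_over K a c = {P}"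
    "P (x_fn - const_fn a) = 2"
    "\<And>v. v \<in> closed_points K \<Longrightarrow> vanishes_to v 1 (x_fn - const_fn a) \<Longrightarrow> v = P"
proof -
  obtain P where P: "P \<in> rational_points K" "vanishes_to P 1 (x_fn - const_fn a)"
    using finite_branch_point_exists[OF assms(1,2)] by blast
  then have closed: "P \<in> closed_points K"
    by (simp add: rational_points_def)
  have "order a D = Suc (order a (pderiv D))"
    using assms(1) D_nonzero by (intro order_pderiv) (simp_all add: order_root)
  then have "order a D = 1"
    using assms(2) by (simp add: order_0I)
  note unique = finite_branch_point_unique[OF this closed P(2)]
  show ?thesis
  proof
    show "P \<in> rational_points K"
      by (rule P(1))
    show "P (x_fn - const_fn a) = 2"
      by (rule unique(2))
    show eq: "v = P" if "v \<in> closed_points K" "vanishes_to v 1 (x_fn - const_fn a)" for v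
      using unique(3)[OF that] by simp
    have "P \<in> points_over K a c"
      using closed P(2) y_value_at_branch_point[OF closed P(2) c]
      by (simp add: points_over_def has_value_iff)
    moreover have "v = P" if "v \<in> points_over K a c" for v
      using that eq by (simp add: points_over_def has_value_iff)
    ultimately show "points_over K a c = {P}"
      by blast
  qed
qed

lemma polyfun_monom: "polyfun (monom 1 n) = x_fn [^] n"
  unfolding x_fn_def ratfun_power to_fract_power[symmetric] by (simp only: monom_altdef smult_1_left)

text \<open>
  The conjugate of \<open>y\<close> is \<open>- y - p\<close>, and the two have product \<open>x ^ n\<close>. Away from infinity, \<open>y\<close>
  can hence only vanish above \<open>x = 0\<close>.
\<close>

lemma y_fn_norm:
  assumes "q = monom 1 n"
  shows "y_fn \<otimes> (- y_fn - polyfun p) = x_fn [^] n"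
  by (simp add: y_fn_def mult_Pair assms flip: polyfun_monom)

text \<open>
  At \<open>O\<close> the conjugate of \<open>y\<close> is a unit and \<open>x\<close> a uniformizer, so the norm gives the order
  \<open>2 m\<close>. At infinity \<open>2 y = z - p\<close>, where \<open>p\<close> has the larger pole, of order \<open>2 m\<close>.
\<close>

lemma order_y:
  assumes q: "q = monom 1 (2 * m)" and "0 < m" "degree p = m" "degree D = 2 * m - 1"
    and "poly p 0 \<noteq> 0"
    and inf: "points_at_infinity K = {Pinf}" and orig: "points_over K 0 0 = {Orig}"
    and v: "v \<in> closed_points K"
  shows "v y_fn = int (2 * m) * (of_bool (v = Orig) - of_bool (v = Pinf))"
proof -
  have distinct: "Pinf \<noteq> Orig"
  proof
    assume "Pinf = Orig"
    then have O: "Orig \<in> points_at_infinity K" "Orig \<in> points_over K 0 0"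
      using inf orig by auto
    then have "vanishes_to Orig 1 x_fn"
      by (simp add: points_over_def has_value_iff const_fn_0)
    with O(1) show False
      by (simp add: points_at_infinity_eq vanishes_to_def x_fn_nonzero)
  qed
  have conj_nonzero: "- y_fn - polyfun p \<noteq> 0"
    by (simp add: y_fn_def)
  have norm: "v y_fn + v (- y_fn - polyfun p) = int (2 * m) * v x_fn"
    using point_mult[OF v y_fn_nonzero conj_nonzero] point_pow[OF v x_fn_nonzero]
    unfolding y_fn_norm[OF q] by simp
  consider "v = Pinf" | "v = Orig" | "v \<noteq> Pinf" "v \<noteq> Orig"
    by blast
  then show ?thesis
  proof cases
    case 1
    then have vinf: "v \<in> points_at_infinity K"
      using inf by simp
    then have neg: "v x_fn < 0"
      by (simp add: points_at_infinity_eq)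
    have x: "v x_fn = - 2" and z: "v z_fn = - int (2 * m - 1)"
      using order_infinity_uniformizer[OF v neg] infinity_unique(1)[OF vinf] assms(4) by simp_all
    have "p \<noteq> 0"
      using assms(5) by auto
    have p: "v (polyfun p) = - int (2 * m)"
      using polynomial_pole_order[OF v neg \<open>p \<noteq> 0\<close>] x assms(3) by simp
    have "vanishes_to v (v (- polyfun p) + 1) z_fn"
      unfolding point_minus[OF v] using p z \<open>0 < m\<close> by (simp add: vanishes_to_def)
    moreover have "- polyfun p \<noteq> 0"
      using \<open>p \<noteq> 0\<close> by simp
    ultimately have "v (- polyfun p + z_fn) = v (- polyfun p)"
      using point_add_dominant(2)[OF v] by blast
    moreover have "- polyfun p + z_fn = const_fn 2 \<otimes> y_fn"
      by (simp add: root_fn_def const_fn_2 y_fn_def ratfun_mult)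
    ultimately have "v (const_fn 2 \<otimes> y_fn) = - int (2 * m)"
      using p point_minus[OF v, of "polyfun p"] by metis
    then have "v y_fn = - int (2 * m)"
      using point_mult[OF v const_fn_nonzero[of 2] y_fn_nonzero] point_const[OF v, of 2] by simp
    with 1 distinct show ?thesis
      by simp
  next
    case 2
    then have O: "v \<in> points_over K 0 0"
      using orig by simp
    have x: "v x_fn = 1"
      by (rule split_origin_unique(1)[OF assms(5) O])
    have van: "vanishes_to v 1 (x_fn - const_fn 0)" "vanishes_to v 1 y_fn"
      using O by (simp_all add: points_over_def has_value_iff const_fn_0)
    have "p \<noteq> 0" "order 0 p = 0"
      using assms(5) by (auto simp: order_root)
    then have "v (- polyfun p) = 0"
      using polynomial_vanishing_order[OF v van(1), of p] by (simp only: point_minus[OF v]) simp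
    moreover have "vanishes_to v 1 (- y_fn)" "- polyfun p \<noteq> 0"
      using vanishes_to_minus[OF v van(2)] \<open>p \<noteq> 0\<close> by simp_all
    ultimately have "v (- polyfun p + - y_fn) = 0"
      using point_add_dominant(2)[OF v, of "- polyfun p" "- y_fn"] by simp
    moreover have "- polyfun p + - y_fn = - y_fn - polyfun p"
      by simp
    ultimately have "v (- y_fn - polyfun p) = 0"
      by metis
    with norm x 2 distinct show ?thesis
      by simp
  next
    case 3
    then have "\<not> v x_fn < 0"
      using inf v by (auto simp: points_at_infinity_eq)
    then have x: "vanishes_to v 0 x_fn"
      by (simp add: vanishes_to_def)
    have y: "vanishes_to v 0 y_fn"
      by (rule y_regular[OF v x])
    have "\<not> vanishes_to v 1 y_fn"
    proof
      assume y1: "vanishes_to v 1 y_fn"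
      have "vanishes_to v 0 (- y_fn - polyfun p)"
        by (intro vanishes_to_diff[OF v] vanishes_to_minus[OF v] y polynomial_regular[OF v x])
      then have "0 \<le> v (- y_fn - polyfun p)"
        using conj_nonzero by (simp add: vanishes_to_def)
      with y1 norm have "0 < int (2 * m) * v x_fn"
        using y_fn_nonzero by (simp add: vanishes_to_def)
      then have "vanishes_to v 1 x_fn"
        by (simp add: vanishes_to_def zero_less_mult_iff)
      with y1 v have "v \<in> points_over K 0 0"
        by (simp add: points_over_def has_value_iff const_fn_0)
      with 3 orig show False
        by simp
    qed
    with y have "v y_fn = 0"
      using y_fn_nonzero by (simp add: vanishes_to_def)
    with 3 show ?thesis
      by simp
  qed
qed

lemma order_x_minus_const:
  assumes inf: "points_at_infinity K = {Pinf}"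
    and P: "P \<in> closed_points K" "P (x_fn - const_fn a) = 2"
    and unique: "\<And>v. v \<in> closed_points K \<Longrightarrow> vanishes_to v 1 (x_fn - const_fn a) \<Longrightarrow> v = P"
    and v: "v \<in> closed_points K"
  shows "v (x_fn - const_fn a) = 2 * (of_bool (v = P) - of_bool (v = Pinf))"
proof -
  have nz: "x_fn - const_fn a \<noteq> 0"
    unfolding x_minus_const by simp
  have pole: "v (x_fn - const_fn a) = - 2" if "v = Pinf"
  proof -
    have vinf: "v \<in> points_at_infinity K"
      using inf that by simp
    then have neg: "v x_fn < 0"
      by (simp add: points_at_infinity_eq)
    have "v x_fn = - 2"
      using order_infinity_uniformizer(1)[OF v neg] infinity_unique(1)[OF vinf] by simp
    then show ?thesis
      using polynomial_pole_order[OF v neg, of "[:- a, 1:]"] by (simp add: x_minus_const)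
  qed
  have "v (x_fn - const_fn a) = 0" if "v \<noteq> P" "v \<noteq> Pinf"
  proof -
    have "\<not> v x_fn < 0"
      using inf v that(2) by (auto simp: points_at_infinity_eq)
    then have "vanishes_to v 0 (x_fn - const_fn a)"
      by (intro vanishes_to_diff[OF v] vanishes_to_const[OF v]) (simp add: vanishes_to_def)
    with unique[OF v] that(1) nz show ?thesis
      unfolding vanishes_to_def by linarith
  qed
  with pole P(2) show ?thesis
    by (cases "v = P"; cases "v = Pinf") auto
qed

end

section \<open>Interpolation and the discriminant\<close>

definition vec_poly :: "nat \<Rightarrow> rat vec \<Rightarrow> rat poly" where
  "vec_poly g u = (\<Sum>j\<le>g. monom (u $ j) j)"

lemma coeff_vec_poly: "coeff (vec_poly g u) k = (if k \<le> g then u $ k else 0)"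
  by (simp add: vec_poly_def coeff_sum)

lemma vandermonde_mult:
  assumes "u \<in> carrier_vec (g + 1)" "i < g + 1"
  shows "(mat (g + 1) (g + 1) (\<lambda>(i, j). a (i + 1) ^ j) *\<^sub>v u) $ i = poly (vec_poly g u) (a (i + 1))"
proof -
  have "(mat (g + 1) (g + 1) (\<lambda>(i, j). a (i + 1) ^ j) *\<^sub>v u) $ i
          = (\<Sum>j<g + 1. a (i + 1) ^ j * u $ j)"
    using assms by (simp add: scalar_prod_def lessThan_atLeast0)
  also have "\<dots> = poly (vec_poly g u) (a (i + 1))"
    by (simp add: vec_poly_def poly_sum poly_monom mult.commute flip: lessThan_Suc_atMost)
  finally show ?thesis .
qed

text \<open>
  The Vandermonde matrix is invertible because a polynomial of degree at most \<open>g\<close> with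
  \<open>g + 1\<close> roots vanishes; so its inverse produces the interpolating polynomial.
\<close>

lemma vandermonde_interpolation:
  fixes a :: "nat \<Rightarrow> rat"
  assumes inj: "inj_on a {1..g + 1}"
    and V: "V = mat (g + 1) (g + 1) (\<lambda>(i, j). a (i + 1) ^ j)"
    and w: "w \<in> carrier_vec (g + 1)"
    and i: "i \<in> {1..g + 1}"
  shows "poly (vec_poly g (the (mat_inverse V) *\<^sub>v w)) (a i) = w $ (i - 1)"
proof -
  have V_carrier: "V \<in> carrier_mat (g + 1) (g + 1)"
    by (simp add: V)
  have "u = 0\<^sub>v (g + 1)" if u: "u \<in> carrier_vec (g + 1)" and zero: "V *\<^sub>v u = 0\<^sub>v (g + 1)" for u
  proof -
    have "poly (vec_poly g u) (a k) = 0" if "k \<in> {1..g + 1}" for k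
    proof -
      from that have k: "k - 1 < g + 1" "k - 1 + 1 = k"
        unfolding atLeastAtMost_iff by linarith+
      show ?thesis
        using vandermonde_mult[OF u k(1), of a, folded V] k(1) unfolding zero k(2) by simp
    qed
    then have roots: "a ` {1..g + 1} \<subseteq> {x. poly (vec_poly g u) x = 0}"
      by auto
    have "vec_poly g u = 0"
    proof (rule ccontr)
      assume nz: "vec_poly g u \<noteq> 0"
      have "g + 1 = card (a ` {1..g + 1})"
        using inj by (simp add: card_image)
      also have "\<dots> \<le> card {x. poly (vec_poly g u) x = 0}"
        using roots nz by (intro card_mono poly_roots_finite)
      also have "\<dots> \<le> degree (vec_poly g u)"
        by (rule card_poly_roots_bound[OF nz])
      also have "\<dots> \<le> g"
        by (intro degree_le) (simp add: coeff_vec_poly)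
      finally show False
        by simp
    qed
    then have "u $ k = 0" if "k < g + 1" for k
      using that coeff_vec_poly[of g u k] by simp
    with u show ?thesis
      by (intro eq_vecI) auto
  qed
  then have "det V \<noteq> 0"
    using det_0_iff_vec_prod_zero_field[OF V_carrier] by blast
  then have "V \<in> Units (ring_mat TYPE(rat) (g + 1) ())"
    by (rule det_non_zero_imp_unit[OF V_carrier])
  then obtain B where B: "mat_inverse V = Some B"
    using mat_inverse(1)[OF V_carrier, of "()"] by (cases "mat_inverse V") blast+
  then have VB: "V * B = 1\<^sub>m (g + 1)" and B_carrier: "B \<in> carrier_mat (g + 1) (g + 1)"
    using mat_inverse(2)[OF V_carrier B] by auto
  have Bw: "B *\<^sub>v w \<in> carrier_vec (g + 1)"
    using B_carrier w by simp
  have "V *\<^sub>v (B *\<^sub>v w) = w"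
    using assoc_mult_mat_vec[OF V_carrier B_carrier w] VB w by simp
  moreover have "i - 1 < g + 1" "i - 1 + 1 = i"
    using i unfolding atLeastAtMost_iff by linarith+
  ultimately show ?thesis
    using vandermonde_mult[OF Bw, of "i - 1" a, folded V] by (simp only: B option.sel)
qed

text \<open>
  A multiple root is a common root of \<open>D\<close> and its derivative, which makes their resultant vanish.
\<close>

lemma discriminant_simple_root:
  fixes D :: "rat poly"
  assumes "discriminant D \<noteq> 0" "poly D a = 0"
  shows "poly (pderiv D) a \<noteq> 0"
proof
  assume "poly (pderiv D) a = 0"
  have "resultant D (pderiv D) \<noteq> 0" "lead_coeff D \<noteq> 0"
    using assms(1) by (auto simp: discriminant_def)
  then have "degree (gcd D (pderiv D)) = 0" "D \<noteq> 0"
    by (auto simp: resultant_0_gcd)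
  moreover have "[:- a, 1:] dvd gcd D (pderiv D)"
    using assms(2) \<open>poly (pderiv D) a = 0\<close> by (simp add: poly_eq_0_iff_dvd)
  ultimately have "degree [:- a, 1:] \<le> 0"
    using dvd_imp_degree_le[of "[:- a, 1:]" "gcd D (pderiv D)"] by simp
  then show False
    by simp
qed

text \<open>
  The leading terms of \<open>p\<^sup>2\<close> and \<open>4 x ^ (2 g + 2)\<close> cancel: with \<open>p = r + 2 x ^ (g + 1)\<close> the
  difference is \<open>r (r + 4 x ^ (g + 1))\<close>.
\<close>

lemma discriminant_factored:
  fixes r :: "rat poly"
  assumes "p = r + monom 2 (g + 1)"
  shows "p\<^sup>2 - 4 * monom 1 (2 * g + 2) = r * (r + monom 4 (g + 1))"
proof -
  have "(monom 2 (g + 1) :: rat poly)\<^sup>2 = monom 4 (2 * g + 2)"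
    by (simp add: power2_eq_square mult_monom mult_2)
  moreover have "4 * monom (1 :: rat) (2 * g + 2) = monom 4 (2 * g + 2)"
    by (simp add: numeral_poly smult_monom)
  moreover have "2 * monom (2 :: rat) (g + 1) = monom 4 (g + 1)"
    by (simp add: numeral_poly smult_monom)
  then have "2 * r * monom 2 (g + 1) = r * monom 4 (g + 1)"
    by (metis mult.assoc mult.commute)
  ultimately show ?thesis
    by (simp only: assms power2_sum distrib_left) (simp add: power2_eq_square)
qed

theorem proposition4p9:
  fixes g :: nat
    and a \<epsilon> :: "nat \<Rightarrow> rat"
    and V :: "rat mat"
    and w b :: "rat vec"
    and f\<^sub>1 :: "rat poly"
    and K :: "fn ring"
  assumes "g \<ge> 1"
    and "\<forall>i \<in> {1..g+1}. a i \<noteq> 0"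
    and "inj_on a {1..g+1}"
    and "\<forall>i \<in> {1..g+1}. \<epsilon> i \<in> {1, -1}"
    and "\<not> (\<forall>i \<in> {1..g+1}. \<epsilon> i = -1)"
    and "V = mat (g+1) (g+1) (\<lambda>(i, j). a (i+1) ^ j)"
    and "w = vec (g+1) (\<lambda>i. - 2 * a (i+1) ^ (g+1) - 2 * \<epsilon> (i+1) * a (i+1) ^ (g+1))"
    and "b = the (mat_inverse V) *\<^sub>v w"
    and "f\<^sub>1 = (\<Sum>j\<le>g. monom (b $ j) j) + monom 2 (g+1)"
    and "b $ g \<noteq> 0"
    and "discriminant (monom (-4) (2*g+2) + f\<^sub>1 ^ 2) \<noteq> 0"
    and "K = function_field f\<^sub>1 (monom 1 (2*g+2))"
  shows "\<exists>Pinf Orig. points_at_infinity K = {Pinf} \<and> points_over K 0 0 = {Orig} \<and>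
           (\<forall>i \<in> {1..g+1}. \<exists>P. points_over K (a i) (\<epsilon> i * a i ^ (g+1)) = {P} \<and>
              defines_K2T_element K Pinf Orig P)"
proof -
  define r where "r = vec_poly g b"
  let ?q = "monom 1 (2 * g + 2) :: rat poly"
  define D where "D = f\<^sub>1\<^sup>2 - 4 * ?q"
  have f1: "f\<^sub>1 = r + monom 2 (g + 1)"
    by (simp add: assms(9) r_def vec_poly_def)
  have D_eq: "D = r * (r + monom 4 (g + 1))"
    unfolding D_def by (rule discriminant_factored[OF f1])
  have "4 * ?q = - monom (- 4) (2 * g + 2)"
    by (simp add: numeral_poly smult_monom minus_monom)
  then have "D = monom (- 4) (2 * g + 2) + f\<^sub>1\<^sup>2"
    by (simp add: D_def)
  with assms(11) have disc: "discriminant D \<noteq> 0"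
    by simp
  have deg_r: "degree r = g"
    using assms(10) by (intro antisym degree_le le_degree) (simp_all add: r_def coeff_vec_poly)
  have "r \<noteq> 0"
    using deg_r assms(1) by auto
  have deg_s: "degree (r + monom 4 (g + 1)) = g + 1"
    by (subst degree_add_eq_right) (simp_all add: deg_r degree_monom_eq)
  then have "r + monom 4 (g + 1) \<noteq> 0"
    by auto
  with \<open>r \<noteq> 0\<close> have "degree D = degree r + degree (r + monom 4 (g + 1))"
    unfolding D_eq by (rule degree_mult_eq)
  then have deg_D: "degree D = 2 * g + 1"
    unfolding deg_r deg_s by simp
  have deg_p: "degree f\<^sub>1 = g + 1"
    unfolding f1 by (subst degree_add_eq_right) (simp_all add: deg_r degree_monom_eq)
  \<comment> \<open>A zero of \<open>r\<close> at \<open>0\<close> would be a double zero of \<open>D = r (r + 4 x ^ (g + 1))\<close>.\<close>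
  have p0: "poly f\<^sub>1 0 \<noteq> 0"
  proof
    assume "poly f\<^sub>1 0 = 0"
    then have "poly r 0 = 0"
      by (simp add: f1 poly_monom)
    then have "poly D 0 = 0" "poly (pderiv D) 0 = 0"
      by (simp_all add: D_eq pderiv_mult pderiv_add poly_monom)
    with discriminant_simple_root[OF disc] show False
      by blast
  qed
  have odd_D: "odd (degree D)"
    by (simp add: deg_D)
  interpret H: odd_hyperelliptic f\<^sub>1 ?q D K
    unfolding assms(12) D_def
    by unfold_locales (rule odd_D[unfolded D_def])
  obtain Pinf where Pinf: "Pinf \<in> rational_points K" "points_at_infinity K = {Pinf}"
    using H.infinity_exists H.infinity_unique(2) by blast
  have "poly ?q 0 = 0"
    by (simp add: poly_monom)
  then obtain Orig where Orig: "Orig \<in> rational_points K" "points_over K 0 0 = {Orig}"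
    using H.split_origin_exists[OF p0] H.split_origin_unique(2)[OF p0] by blast
  have ord_y: "v y_fn = int (2 * (g + 1)) * (of_bool (v = Orig) - of_bool (v = Pinf))"
    if "v \<in> closed_points K" for v
    by (rule H.order_y[OF _ _ _ _ p0 Pinf(2) Orig(2) that]) (simp_all add: deg_p deg_D)
  have "\<exists>P. points_over K (a i) (\<epsilon> i * a i ^ (g + 1)) = {P} \<and> defines_K2T_element K Pinf Orig P"
    if i: "i \<in> {1..g + 1}" for i
  proof -
    let ?c = "\<epsilon> i * a i ^ (g + 1)"
    have "poly r (a i) = w $ (i - 1)"
      unfolding r_def assms(8)
      by (rule vandermonde_interpolation[OF assms(3,6) _ i]) (simp add: assms(7))
    also have "\<dots> = - 2 * a i ^ (g + 1) - 2 * ?c"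
    proof -
      have "i - 1 < g + 1" "i - 1 + 1 = i"
        using i unfolding atLeastAtMost_iff by linarith+
      then show ?thesis
        unfolding assms(7) by (simp only: index_vec mult.assoc)
    qed
    finally have p_a: "poly f\<^sub>1 (a i) = - 2 * ?c"
      by (simp add: f1 poly_monom)
    have "\<epsilon> i \<in> {1, - 1}"
      using assms(4) i by blast
    then have "(\<epsilon> i)\<^sup>2 = 1"
      by auto
    then have "?c\<^sup>2 = a i ^ ((g + 1) * 2)"
      unfolding power_mult power_mult_distrib by simp
    then have q_a: "poly ?q (a i) = ?c\<^sup>2"
      by (simp add: poly_monom mult.commute)
    have D_a: "poly D (a i) = 0"
    proof -
      have "poly D (a i) = (poly f\<^sub>1 (a i))\<^sup>2 - 4 * poly ?q (a i)"
        unfolding D_def by (simp only: poly_diff poly_mult poly_power poly_numeral)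
      then show ?thesis
        unfolding p_a q_a by (simp add: power2_eq_square)
    qed
    obtain P where P: "P \<in> rational_points K" "points_over K (a i) ?c = {P}"
      "P (x_fn - const_fn (a i)) = 2"
      "\<And>v. v \<in> closed_points K \<Longrightarrow> vanishes_to v 1 (x_fn - const_fn (a i)) \<Longrightarrow> v = P"
      using H.branch_point[OF D_a discriminant_simple_root[OF disc D_a] p_a q_a] by blast
    have closed: "Pinf \<in> closed_points K" "Orig \<in> closed_points K" "P \<in> closed_points K"
      using Pinf Orig P by (auto simp: rational_points_def)
    let ?x = "x_fn - const_fn (a i)"
    have x_nz: "?x \<noteq> 0"
      unfolding H.x_minus_const by simp
    have ord_x: "v ?x = 2 * (of_bool (v = P) - of_bool (v = Pinf))" if "v \<in> closed_points K" for v
      by (rule H.order_x_minus_const[OF Pinf(2) closed(3) P(3) P(4) that])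
    have "defines_K2T_element K Pinf Orig P"
    proof (rule H.defines_K2T_elementI[where N = "2 * (g + 1)" and Q = Pinf])
      show "{Pinf, Orig, P} \<subseteq> rational_points K"
        using Pinf(1) Orig(1) P(1) by simp
      have "Orig x_fn = 1"
        using H.split_origin_unique(1)[OF p0] Orig(2) by simp
      moreover have "Pinf x_fn < 0"
        using Pinf(2) H.points_at_infinity_eq by auto
      ultimately have "Pinf \<noteq> Orig"
        by auto
      moreover have "Pinf \<noteq> P"
        using ord_x[OF closed(3)] P(3) by auto
      moreover have "Orig \<noteq> P"
      proof
        assume "Orig = P"
        then have "vanishes_to P 1 x_fn" "vanishes_to P 1 ?x"
          using \<open>Orig x_fn = 1\<close> P(3) by (simp_all add: vanishes_to_def)
        then have "vanishes_to P 1 (x_fn - ?x)"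
          by (rule H.vanishes_to_diff[OF closed(3)])
        moreover have "a i \<noteq> 0"
          using assms(2) i by blast
        ultimately show False
          using H.point_const[OF closed(3), of "a i"] H.const_fn_nonzero[of "a i"]
          by (simp add: vanishes_to_def)
      qed
      ultimately show "distinct [Pinf, Orig, P]"
        by simp
      fix R assume "R \<in> {Pinf, Orig, P}"
      then consider "R = Pinf" | "R = Orig" | "R = P"
        by blast
      then show "\<exists>h. h \<noteq> 0 \<and> (\<forall>v \<in> closed_points K.
          v h = int (2 * (g + 1)) * (of_bool (v = R) - of_bool (v = Pinf)))"
      proof cases
        case 1
        have "\<one>\<^bsub>K\<^esub> \<noteq> 0"
          by (simp add: H.one_K)
        with 1 H.point_one show ?thesis
          by (intro exI[of _ "\<one>\<^bsub>K\<^esub>"]) auto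
      next
        case 2
        with ord_y H.y_fn_nonzero show ?thesis
          by blast
      next
        case 3
        have "v (?x [^]\<^bsub>K\<^esub> (g + 1)) = int (2 * (g + 1)) * (of_bool (v = R) - of_bool (v = Pinf))"
          if "v \<in> closed_points K" for v
          using H.point_pow[OF that x_nz, of "g + 1"] ord_x[OF that] 3 by simp
        with H.pow_nonzero[OF x_nz] show ?thesis
          by blast
      qed
    qed simp
    with P(2) show ?thesis
      by blast
  qed
  with Pinf(2) Orig(2) show ?thesis
    by blast
qed

end
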